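(* Let $H=([n],[m],E)$ be a bigraph whose base graph is connected, and for $j\in[m]$ let $d_j$ be the degree of the right vertex $j$ in $H$. For any vector $\vec q=(q_1,\dots,q_n)\in(0,1)^n$ and any $\lambda>0$, the vector $\lambda\vec q$ lies on the boundary $\partial(H)$ if and only if $\lambda$ is the optimal value of the following program, whose variables are $\lambda$, reals $x_{jk}$ ($j\in[m]$, $k\in[d_j]$) and $C_{i,k_1,\dots,k_m}$ ($i\in[n]$, $k_j\in[d_j]$ for $j\in[m]$): \begin{align*} \min\ & \lambda\\ \text{s.t. } & \sum_{i\in[n]} C_{i,k_1,\dots,k_m}\ge 1 \text{ for all } k_j\in[d_j],\ j\in[m];\\ & C_{i,k_1,\dots,k_m} \text{ does not depend on } k_j \text{ whenever } (i,j)\in([n]\times[m])\setminus E;\\ & \sum_{k_1\in[d_1],\dots,k_m\in[d_m]}\Big(\prod_{j\in[m]}x_{jk_j}\Big)C_{i,k_1,\dots,k_m}=\lambda q_i \text{ for } i\in[n];\\ & \sum_{k\in[d_j]}x_{jk}=1 \text{ for } j\in[m];\\ & x_{jk}\in[0,1] \text{ for } j\in[m],k\in[d_j];\\ & C_{i,k_1,\dots,k_m}\in\{0,1\} \text{ for all } i\in[n],\ k_j\in[d_j],\ j\in[m]. \end{align*}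
   Context: A bigraph $H=([n],[m],E)$ has left part $[n]$ (events), right part $[m]$ (variables) and edge set $E\subseteq[n]\times[m]$; $\mathcal N_H(v)$ denotes the neighborhood of $v$. The base graph $G_H$ is the graph on $[n]$ in which distinct $u,v$ are adjacent iff they have a common neighbor in $H$. Equip $[0,1]^m$ with Lebesgue measure $\mu$. A family $\mathcal A=\{A_1,\dots,A_n\}$ of measurable subsets of $[0,1]^m$ conforms with $H$ (written $\mathcal A\sim H$) if each $A_i$ is a cylinder depending only on the coordinates in $\mathcal N_H(i)$, i.e. $A_i=B_i\times[0,1]^{[m]\setminus\mathcal N_H(i)}$ for a measurable $B_i\subseteq[0,1]^{\mathcal N_H(i)}$. Write $\mu(\mathcal A)=(\mu(A_1),\dots,\mu(A_n))$. The interior $\mathcal I(H)$ is the set of $\vec p\in(0,1)^n$ such that $\mu(\bigcap_i([0,1]^m\setminus A_i))>0$ for every $\mathcal A\sim H$ with $\mu(\mathcal A)=\vec p$. The boundary $\partial(H)$ is the set of $\vec p\in(0,1]^n$ such that $(1-\epsilon)\vec p\in\mathcal I(H)$ and $(1+\epsilon)\vec p\notin\mathcal I(H)$ for every $\epsilon\in(0,1)$. (Equivalently, this is the setting of events generated by independent random variables, where event $i$ depends only on variables in $\mathcal N_H(i)$.)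
   Formalization: Every right vertex j is assumed to have degree d_j ≥ 1; if some d_j = 0 the constraint that the x_{jk} sum to 1 is an empty sum equal to 1, so the program is infeasible while boundary vectors still exist. *)

theory Defs
  imports "HOL-Analysis.Analysis"
begin

text \<open>
  A bigraph \<open>([n], [m], E)\<close> is given by \<open>n\<close>, \<open>m\<close> and \<open>E \<subseteq> {1..n} \<times> {1..m}\<close>. Vectors indexed by
  \<open>[n]\<close> are functions \<open>nat \<Rightarrow> real\<close> whose values outside \<open>{1..n}\<close> are irrelevant.
\<close>

definition left_nbhd :: "(nat \<times> nat) set \<Rightarrow> nat \<Rightarrow> nat set" where
  "left_nbhd E i = E `` {i}"

definition right_nbhd :: "(nat \<times> nat) set \<Rightarrow> nat \<Rightarrow> nat set" where
  "right_nbhd E j = E\<inverse> `` {j}"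

definition right_degree :: "(nat \<times> nat) set \<Rightarrow> nat \<Rightarrow> nat" where
  "right_degree E j = card (right_nbhd E j)"

definition base_graph :: "nat \<Rightarrow> (nat \<times> nat) set \<Rightarrow> (nat \<times> nat) set" where
  "base_graph n E = {(u, v). u \<in> {1..n} \<and> v \<in> {1..n} \<and> u \<noteq> v \<and>
     left_nbhd E u \<inter> left_nbhd E v \<noteq> {}}"

definition base_graph_connected :: "nat \<Rightarrow> (nat \<times> nat) set \<Rightarrow> bool" where
  "base_graph_connected n E \<longleftrightarrow> (\<forall>u\<in>{1..n}. \<forall>v\<in>{1..n}. (u, v) \<in> (base_graph n E)\<^sup>*)"

definition unit_interval :: "real measure" where
  "unit_interval = restrict_space lborel {0..1}"

text \<open>
  The completion turns the product of the Borel measures into Lebesgue measure on \<open>[0,1]\<^sup>J\<close>; its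
  underlying space consists of the extensional functions \<open>J \<rightarrow>\<^sub>E {0..1}\<close>.
\<close>

definition cube :: "nat set \<Rightarrow> (nat \<Rightarrow> real) measure" where
  "cube J = completion (\<Pi>\<^sub>M j\<in>J. unit_interval)"

text \<open>\<open>prod_emb\<close> forms the cylinder with base \<open>B\<close>, a subset of the cube over \<open>left_nbhd E i\<close>, inside
  \<open>[0,1]\<^sup>m\<close>.\<close>

definition conforms :: "nat \<Rightarrow> nat \<Rightarrow> (nat \<times> nat) set \<Rightarrow> (nat \<Rightarrow> (nat \<Rightarrow> real) set) \<Rightarrow> bool" where
  "conforms n m E A \<longleftrightarrow> (\<forall>i\<in>{1..n}. \<exists>B\<in>sets (cube (left_nbhd E i)).
     A i = prod_emb {1..m} (\<lambda>_. unit_interval) (left_nbhd E i) B)"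

text \<open>The outer intersection with the space only matters for \<open>n = 0\<close>.\<close>

definition bigraph_interior :: "nat \<Rightarrow> nat \<Rightarrow> (nat \<times> nat) set \<Rightarrow> (nat \<Rightarrow> real) set" where
  "bigraph_interior n m E = {p \<in> {1..n} \<rightarrow> {0<..<1}.
     \<forall>A. conforms n m E A \<and> (\<forall>i\<in>{1..n}. measure (cube {1..m}) (A i) = p i) \<longrightarrow>
       measure (cube {1..m})
         (space (cube {1..m}) \<inter> (\<Inter>i\<in>{1..n}. space (cube {1..m}) - A i)) > 0}"

definition bigraph_boundary :: "nat \<Rightarrow> nat \<Rightarrow> (nat \<times> nat) set \<Rightarrow> (nat \<Rightarrow> real) set" where
  "bigraph_boundary n m E = {p \<in> {1..n} \<rightarrow> {0<..1}. \<forall>\<epsilon>\<in>{0<..<1}.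
     (\<lambda>i. (1 - \<epsilon>) * p i) \<in> bigraph_interior n m E \<and>
     (\<lambda>i. (1 + \<epsilon>) * p i) \<notin> bigraph_interior n m E}"

definition multi_indices :: "nat \<Rightarrow> (nat \<times> nat) set \<Rightarrow> (nat \<Rightarrow> nat) set" where
  "multi_indices m E = (\<Pi>\<^sub>E j\<in>{1..m}. {1..right_degree E j})"

definition program_feasible ::
  "nat \<Rightarrow> nat \<Rightarrow> (nat \<times> nat) set \<Rightarrow> (nat \<Rightarrow> real) \<Rightarrow>
   real \<Rightarrow> (nat \<Rightarrow> nat \<Rightarrow> real) \<Rightarrow> (nat \<Rightarrow> (nat \<Rightarrow> nat) \<Rightarrow> real) \<Rightarrow> bool" where
  "program_feasible n m E q l x C \<longleftrightarrow>
     (\<forall>k\<in>multi_indices m E. (\<Sum>i\<in>{1..n}. C i k) \<ge> 1) \<and>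
     (\<forall>(i, j)\<in>({1..n} \<times> {1..m}) - E. \<forall>k\<in>multi_indices m E. \<forall>k'\<in>{1..right_degree E j}.
        C i (k(j := k')) = C i k) \<and>
     (\<forall>i\<in>{1..n}. (\<Sum>k\<in>multi_indices m E. (\<Prod>j\<in>{1..m}. x j (k j)) * C i k) = l * q i) \<and>
     (\<forall>j\<in>{1..m}. (\<Sum>k\<in>{1..right_degree E j}. x j k) = 1) \<and>
     (\<forall>j\<in>{1..m}. \<forall>k\<in>{1..right_degree E j}. x j k \<in> {0..1}) \<and>
     (\<forall>i\<in>{1..n}. \<forall>k\<in>multi_indices m E. C i k \<in> {0, 1})"

definition program_optimal_value ::
  "nat \<Rightarrow> nat \<Rightarrow> (nat \<times> nat) set \<Rightarrow> (nat \<Rightarrow> real) \<Rightarrow> real \<Rightarrow> bool" where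
  "program_optimal_value n m E q l \<longleftrightarrow>
     (\<exists>x C. program_feasible n m E q l x C) \<and>
     (\<forall>l' x C. program_feasible n m E q l' x C \<longrightarrow> l \<le> l')"

end

theory Submission
  imports Defs "HOL-Probability.Infinite_Product_Measure"
begin

text \<open>
  Replace the uniform distributions of the variables, one at a time, by finitely supported ones.
  Fixing the value of variable \<open>j\<close> only affects the conditional probabilities of its \<open>d\<^sub>j\<close> neighbours,
  so by a Caratheodory argument \<open>d\<^sub>j\<close> values suffice to keep these probabilities from increasing (up to an
  arbitrary loss \<open>\<epsilon>\<close>), and the values can be chosen such that the events still cover. Hence every cover by
  events of measure at most \<open>\<lambda>q\<close> gives, for each \<open>\<epsilon> > 0\<close>, a point of the program with
  probabilities at most \<open>\<lambda>q + \<epsilon>\<close>; conversely such points are realised in the cube by cutting \<open>[0,1]\<close>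
  into intervals. By compactness there is a least \<open>s\<close> for which some point of the program has
  probabilities at most \<open>sq\<close>. If one of these inequalities were strict, then connectivity of the base
  graph would allow the slack to be spread to all events, contradicting minimality. So \<open>s\<close> is the optimum
  of the program, and it is also the threshold between interior and non-interior on the ray through \<open>q\<close>.
\<close>

subsection \<open>Finite sampling of means\<close>

text \<open>The interior and the program prescribe probabilities exactly, whereas discretization
  controls them only from above. Both sides are therefore relaxed to upper bounds
  (\<open>event_cover\<close> with bounds on the measures, \<open>program_dominated\<close>), and
  exactness is restored by two different devices. In the cube a probability can be raised
  continuously by adding a thin slab over one variable. In the program the number of values per
  variable is fixed, so equality has to come from minimality. Connectivity enters exactly here: with
  several components, a cover by the events of one component would leave slack in the others, and
  that slack could not be passed back to lower the optimum.

  The bound on the number of values does not depend on \<open>\<epsilon>\<close>. All approximations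
  thus lie in one and the same program, which is what allows a compactness argument to remove the
  loss.\<close>

lemma homogeneous_system_nontrivial_solution:
  fixes F :: "'i \<Rightarrow> 's \<Rightarrow> real"
  assumes "finite I" "finite S" "card I < card S"
  shows "\<exists>v. (\<exists>s\<in>S. v s \<noteq> 0) \<and> (\<forall>i\<in>I. (\<Sum>s\<in>S. v s * F i s) = 0)"
  using assms
proof (induction I arbitrary: S F rule: finite_induct)
  case empty
  then have "S \<noteq> {}" by auto
  then show ?case by (intro exI[of _ "\<lambda>_. 1"]) auto
next
  case (insert i I)
  show ?case
  proof (cases "\<forall>s\<in>S. F i s = 0")
    case True
    have "card I < card S" using insert by simp
    from insert.IH[OF insert.prems(1) this, of F] obtain v where
      "\<exists>s\<in>S. v s \<noteq> 0" "\<forall>i\<in>I. (\<Sum>s\<in>S. v s * F i s) = 0" by blast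
    with True show ?thesis by (intro exI[of _ v]) auto
  next
    case False
    then obtain s0 where s0: "s0 \<in> S" "F i s0 \<noteq> 0" by blast
    \<comment> \<open>Gaussian elimination: equation \<open>i\<close> has a nonzero coefficient at
      \<open>s0\<close>, so this unknown is eliminated from the other equations and recovered below
      as \<open>c\<close>.\<close>
    define S' where "S' = S - {s0}"
    have S: "S = insert s0 S'" "s0 \<notin> S'" "finite S'" using s0 insert.prems by (auto simp: S'_def)
    have "card I < card S'" using insert.prems insert.hyps S by auto
    from insert.IH[OF S(3) this, of "\<lambda>k s. F k s - F k s0 * F i s / F i s0"] obtain v where v:
      "\<exists>s\<in>S'. v s \<noteq> 0" "\<forall>k\<in>I. (\<Sum>s\<in>S'. v s * (F k s - F k s0 * F i s / F i s0)) = 0" by blast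
    define c where "c = - (\<Sum>s\<in>S'. v s * F i s) / F i s0"
    define u where "u = v(s0 := c)"
    have sum_u: "(\<Sum>s\<in>S. u s * F k s) = c * F k s0 + (\<Sum>s\<in>S'. v s * F k s)" for k
      using S by (simp add: u_def) (rule sum.cong, auto)
    have "(\<Sum>s\<in>S. u s * F k s) = 0" if "k \<in> insert i I" for k
    proof (cases "k = i")
      case True
      then show ?thesis using s0 by (simp add: sum_u c_def)
    next
      case False
      with that have "(\<Sum>s\<in>S'. v s * (F k s - F k s0 * F i s / F i s0)) = 0" using v by auto
      moreover have "(\<Sum>s\<in>S'. v s * (F k s - F k s0 * F i s / F i s0)) =
        (\<Sum>s\<in>S'. v s * F k s) + c * F k s0"
        by (simp add: c_def right_diff_distrib sum_subtractf sum_distrib_left sum_distrib_right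
            sum_divide_distrib) (rule sum.cong, auto)
      ultimately show ?thesis by (simp add: sum_u)
    qed
    moreover have "\<exists>s\<in>S. u s \<noteq> 0" using v(1) S by (auto simp: u_def)
    ultimately show ?thesis by blast
  qed
qed

text \<open>
  A linear dependency between the vectors lets one weight be pushed to \<open>0\<close>. Moving in the direction
  that increases the total weight and then normalising can only lower the nonnegative means, so \<open>d\<close>
  points suffice instead of the usual \<open>d + 1\<close>.
\<close>

lemma caratheodory_below:
  fixes F :: "'i \<Rightarrow> 's \<Rightarrow> real"
  assumes "finite I" "card I \<le> d" "1 \<le> d"
    and "finite S" "\<And>i s. i \<in> I \<Longrightarrow> s \<in> S \<Longrightarrow> 0 \<le> F i s"
    and "\<And>s. s \<in> S \<Longrightarrow> 0 \<le> w s" "sum w S = 1"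
  shows "\<exists>T w'. T \<subseteq> S \<and> card T \<le> d \<and> (\<forall>s\<in>T. 0 < w' s) \<and> sum w' T = 1 \<and>
    (\<forall>i\<in>I. (\<Sum>s\<in>T. w' s * F i s) \<le> (\<Sum>s\<in>S. w s * F i s))"
  using assms(4-)
proof (induction "card S" arbitrary: S w rule: less_induct)
  case less
  note fin = \<open>finite S\<close>
  have remove: ?case if s1: "s1 \<in> S" "u s1 = 0" and u: "\<And>s. s \<in> S \<Longrightarrow> 0 \<le> u s" "sum u S = 1"
      "\<And>i. i \<in> I \<Longrightarrow> (\<Sum>s\<in>S. u s * F i s) \<le> (\<Sum>s\<in>S. w s * F i s)" for s1 and u :: "'s \<Rightarrow> real"
  proof -
    have red: "(\<Sum>s\<in>S - {s1}. u s * g s) = (\<Sum>s\<in>S. u s * g s)" for g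
      using s1 fin by (simp add: sum.remove)
    have red1: "sum u (S - {s1}) = sum u S" using s1 fin by (simp add: sum.remove)
    have "card (S - {s1}) < card S" using s1 fin by (metis card_Diff1_less)
    moreover have "finite (S - {s1})" "sum u (S - {s1}) = 1" using fin u red1 by simp_all
    moreover have "\<And>i s. i \<in> I \<Longrightarrow> s \<in> S - {s1} \<Longrightarrow> 0 \<le> F i s" using less.prems(2) by blast
    moreover have "\<And>s. s \<in> S - {s1} \<Longrightarrow> 0 \<le> u s" using u(1) by blast
    ultimately obtain T w' where
      "T \<subseteq> S - {s1}" "card T \<le> d" "\<forall>s\<in>T. 0 < w' s" "sum w' T = 1"
      "\<forall>i\<in>I. (\<Sum>s\<in>T. w' s * F i s) \<le> (\<Sum>s\<in>S - {s1}. u s * F i s)"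
      using less.hyps[of "S - {s1}" u] by blast
    then show ?thesis using u(3) unfolding red by (intro exI[of _ T] exI[of _ w']) fastforce
  qed
  consider s1 where "s1 \<in> S" "w s1 = 0" | "card S \<le> d" "\<forall>s\<in>S. 0 < w s"
    | "d < card S" "\<forall>s\<in>S. 0 < w s"
    using less.prems(3) by (metis le_less not_le)
  then show ?case
  proof cases
    case 1
    then show ?thesis using remove[of s1 w] less.prems by auto
  next
    case 2
    then show ?thesis using less.prems by (intro exI[of _ S] exI[of _ w]) auto
  next
    case 3
    obtain v0 where v0: "\<exists>s\<in>S. v0 s \<noteq> 0" "\<forall>i\<in>I. (\<Sum>s\<in>S. v0 s * F i s) = 0"
      using homogeneous_system_nontrivial_solution[OF \<open>finite I\<close> fin, of F] 3 assms(2) by auto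
    \<comment> \<open>The sign is chosen so that moving along \<open>v\<close> does not decrease the
      total weight; hence \<open>\<sigma> \<ge> 1\<close> below.\<close>
    define v where "v = (if sum v0 S \<ge> 0 then v0 else (\<lambda>s. - v0 s))"
    have v: "\<exists>s\<in>S. v s \<noteq> 0" "\<forall>i\<in>I. (\<Sum>s\<in>S. v s * F i s) = 0" "sum v S \<ge> 0"
      using v0 by (auto simp: v_def sum_negf)
    show ?thesis
    proof (cases "\<exists>s\<in>S. v s < 0")
      case True
      define V where "V = {s\<in>S. v s < 0}"
      have "finite V" "V \<noteq> {}" using True fin by (auto simp: V_def)
      \<comment> \<open>The first time at which a weight \<open>w s + t * v s\<close> reaches 0;
        only points with \<open>v s < 0\<close> can get there.\<close>
      define t where "t = Min ((\<lambda>s. w s / - v s) ` V)"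
      obtain s1 where s1: "s1 \<in> V" "t = w s1 / - v s1"
        using obtains_MIN[OF \<open>finite V\<close> \<open>V \<noteq> {}\<close>, of "\<lambda>s. w s / - v s"] unfolding t_def by metis
      have t_le: "t \<le> w s / - v s" if "s \<in> V" for s
        using that \<open>finite V\<close> unfolding t_def by auto
      have "0 < w s1 / - v s1" using s1 3 by (intro divide_pos_pos) (auto simp: V_def)
      then have "t \<ge> 0" using s1 by simp
      have nonneg: "0 \<le> w s + t * v s" if "s \<in> S" for s
      proof (cases "v s < 0")
        case True
        then have "t * - v s \<le> w s" using t_le[of s] that by (simp add: V_def field_simps)
        then show ?thesis by simp
      next
        case False
        then show ?thesis using \<open>t \<ge> 0\<close> 3 that by (simp add: less_imp_le)
      qed
      define \<sigma> where "\<sigma> = 1 + t * sum v S"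
      have \<sigma>: "\<sigma> \<ge> 1" using \<open>t \<ge> 0\<close> v by (simp add: \<sigma>_def)
      define u where "u s = (w s + t * v s) / \<sigma>" for s
      have lin: "(\<Sum>s\<in>S. u s * g s) = ((\<Sum>s\<in>S. w s * g s) + t * (\<Sum>s\<in>S. v s * g s)) / \<sigma>" for g
        by (simp add: u_def sum_divide_distrib[symmetric] sum_distrib_left sum.distrib[symmetric]
            algebra_simps)
      show ?thesis
      proof (rule remove[of s1 u])
        show "s1 \<in> S" using s1 by (simp add: V_def)
        show "u s1 = 0" using s1 by (simp add: u_def V_def)
        show "0 \<le> u s" if "s \<in> S" for s using nonneg[OF that] \<sigma> by (simp add: u_def)
        show "sum u S = 1" using lin[of "\<lambda>_. 1"] less.prems \<sigma> by (simp add: \<sigma>_def)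
        show "(\<Sum>s\<in>S. u s * F i s) \<le> (\<Sum>s\<in>S. w s * F i s)" if "i \<in> I" for i
        proof -
          \<comment> \<open>The direction \<open>v\<close> leaves the mean unchanged, and dividing a
            nonnegative mean by \<open>\<sigma> \<ge> 1\<close> cannot raise it.\<close>
          have "0 \<le> (\<Sum>s\<in>S. w s * F i s)" using less.prems that by (intro sum_nonneg) auto
          then show ?thesis using lin[of "F i"] v(2) that \<sigma>
            by (simp add: divide_le_eq mult_le_cancel_left1)
        qed
      qed
    next
      case False
      \<comment> \<open>No weight ever decreases along \<open>v\<close>. But then the vanishing sums
        have nonnegative terms, so every \<open>F i\<close> is 0 at \<open>s\<close> and this single
        point suffices.\<close>
      then obtain s where s: "s \<in> S" "v s > 0" using v(1) by force
      have "F i s = 0" if "i \<in> I" for i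
      proof -
        have "v s * F i s = 0"
        proof (rule sum_nonneg_0[OF fin])
          show "\<And>s. s \<in> S \<Longrightarrow> 0 \<le> v s * F i s"
            using that False less.prems(2) by (intro mult_nonneg_nonneg) (auto simp: not_less)
        qed (use v(2) that s in auto)
        then show ?thesis using s by simp
      qed
      moreover have "0 \<le> (\<Sum>s\<in>S. w s * F i s)" if "i \<in> I" for i
        using less.prems that by (intro sum_nonneg) auto
      ultimately show ?thesis using s \<open>1 \<le> d\<close>
        by (intro exI[of _ "{s}"] exI[of _ "\<lambda>_. 1"]) auto
    qed
  qed
qed

text \<open>
  The mean lies in the convex hull of the values, but the hull need not be closed; the loss \<open>\<epsilon>\<close> avoids
  this issue and is removed later by compactness of the program.
\<close>

lemma (in prob_space) finite_sampling_below:
  fixes F :: "'i \<Rightarrow> 'a \<Rightarrow> real"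
  assumes "finite I" "card I \<le> d" "1 \<le> d"
    and F[measurable]: "\<And>i. i \<in> I \<Longrightarrow> F i \<in> borel_measurable M"
    and F01: "\<And>i y. i \<in> I \<Longrightarrow> y \<in> space M \<Longrightarrow> F i y \<in> {0..1}"
    and "AE y in M. Q y" "\<epsilon> > 0"
  shows "\<exists>S w. finite S \<and> S \<subseteq> space M \<and> card S \<le> d \<and> (\<forall>s\<in>S. Q s \<and> 0 < w s) \<and> sum w S = 1 \<and>
    (\<forall>i\<in>I. (\<Sum>s\<in>S. w s * F i s) \<le> expectation (F i) + \<epsilon>)"
proof -
  obtain N where N: "{y\<in>space M. \<not> Q y} \<subseteq> N" "N \<in> null_sets M"
    using AE_E[OF \<open>AE y in M. Q y\<close>] by (metis null_setsI)
  have [measurable]: "N \<in> sets M" using N by auto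
  \<comment> \<open>The values of the vector \<open>F\<close> lie in a unit box, which is cut into
    finitely many cells of side \<open>\<epsilon>\<close>. One representative per cell, weighted by
    the probability of the cell, changes each mean by at most \<open>\<epsilon>\<close>. Points of
    the null set \<open>N\<close> are excluded, so \<open>Q\<close> holds at all
    representatives.\<close>
  define c where "c y = (\<lambda>i\<in>I. \<lfloor>F i y / \<epsilon>\<rfloor>)" for y
  define cell where "cell r = {y \<in> space M - N. \<forall>i\<in>I. \<lfloor>F i y / \<epsilon>\<rfloor> = r i}" for r
  define R where "R = c ` (space M - N)"
  have "R \<subseteq> (\<Pi>\<^sub>E i\<in>I. {0..\<lceil>1 / \<epsilon>\<rceil>})"
  proof (unfold R_def, intro image_subsetI PiE_I)
    fix y i assume yi: "y \<in> space M - N" "i \<in> I"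
    have "F i y / \<epsilon> \<le> 1 / \<epsilon>" "0 \<le> F i y / \<epsilon>"
      using F01[of i y] yi \<open>\<epsilon> > 0\<close> by (auto simp: divide_right_mono)
    then have "\<lfloor>F i y / \<epsilon>\<rfloor> \<in> {0..\<lceil>1 / \<epsilon>\<rceil>}" by (auto simp: le_floor_iff floor_le_iff) linarith
    then show "c y i \<in> {0..\<lceil>1 / \<epsilon>\<rceil>}" using yi by (simp add: c_def)
  qed (auto simp: c_def)
  then have "finite R" by (rule finite_subset) (use \<open>finite I\<close> in \<open>auto intro: finite_PiE\<close>)
  have [measurable]: "cell r \<in> sets M" for r
    unfolding cell_def using \<open>finite I\<close> by measurable
  have cell: "y \<in> cell r \<longleftrightarrow> c y = r" if "y \<in> space M - N" "r \<in> R" for y r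
  proof -
    have "r \<in> extensional I" using that by (auto simp: R_def c_def)
    then show ?thesis using that by (auto simp: cell_def c_def extensional_def fun_eq_iff)
  qed
  have cell_N: "cell r \<subseteq> space M - N" for r by (auto simp: cell_def)
  define rep where "rep r = (SOME y. y \<in> space M - N \<and> c y = r)" for r
  have rep: "rep r \<in> space M - N \<and> c (rep r) = r" if "r \<in> R" for r
    unfolding rep_def by (rule someI_ex) (use that in \<open>auto simp: R_def\<close>)
  have "inj_on rep R" by (metis inj_onI rep)
  have ind: "(\<Sum>r\<in>R. indicator (cell r) y * g r) = g (c y)" if "y \<in> space M - N" for y and g :: "_ \<Rightarrow> real"
  proof -
    have "(\<Sum>r\<in>R. indicator (cell r) y * g r) = (\<Sum>r\<in>R. if r = c y then g r else 0)"
      using that by (intro sum.cong) (auto simp: cell indicator_def)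
    also have "\<dots> = g (c y)" using that \<open>finite R\<close> by (simp add: R_def)
    finally show ?thesis .
  qed
  have AE_N: "AE y in M. y \<in> space M - N" using AE_not_in[OF N(2)] AE_space by eventually_elim simp
  have int: "expectation (\<lambda>y. \<Sum>r\<in>R. indicator (cell r) y * g r) = (\<Sum>r\<in>R. prob (cell r) * g r)"
    for g :: "_ \<Rightarrow> real"
    by (subst Bochner_Integration.integral_sum) (auto simp: emeasure_eq_measure)
  define w where "w s = prob (cell (c s))" for s
  have "expectation (\<lambda>y. \<Sum>r\<in>R. indicator (cell r) y * 1) = expectation (\<lambda>y. 1 :: real)"
  proof (intro integral_cong_AE)
    show "AE y in M. (\<Sum>r\<in>R. indicator (cell r) y * 1) = (1::real)"
      using AE_N by (rule AE_mp) (simp add: ind del: mult_1_right)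
  qed measurable
  then have sum1: "(\<Sum>r\<in>R. prob (cell r)) = 1" by (simp add: int[of "\<lambda>_. 1", simplified] prob_space)
  have reindex: "(\<Sum>s\<in>rep ` R. w s * g s) = (\<Sum>r\<in>R. prob (cell r) * g (rep r))" for g
    using \<open>inj_on rep R\<close> by (simp add: sum.reindex w_def rep)
  have mean: "(\<Sum>s\<in>rep ` R. w s * F i s) \<le> expectation (F i) + \<epsilon>" if "i \<in> I" for i
  proof -
    \<comment> \<open>Within a cell the value at the representative exceeds any other value by less
      than \<open>\<epsilon>\<close>; integrate this pointwise bound.\<close>
    have "(\<Sum>r\<in>R. prob (cell r) * (F i (rep r) - \<epsilon>)) \<le> expectation (F i)"
      unfolding int[symmetric]
    proof (rule integral_mono_AE)
      show "integrable M (F i)"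
        by (rule integrable_const_bound[where B=1]) (use F01 that in force)+
      show "AE y in M. (\<Sum>r\<in>R. indicator (cell r) y * (F i (rep r) - \<epsilon>)) \<le> F i y"
        using AE_N
      proof (rule AE_mp, intro AE_I2 impI)
        fix y assume y: "y \<in> space M - N"
        then have "rep (c y) \<in> cell (c y)" "y \<in> cell (c y)" using cell rep by (auto simp: R_def)
        then have eq: "\<lfloor>F i (rep (c y)) / \<epsilon>\<rfloor> = \<lfloor>F i y / \<epsilon>\<rfloor>" using that by (simp add: cell_def)
        have "F i (rep (c y)) / \<epsilon> < F i y / \<epsilon> + 1"
          using floor_correct[of "F i y / \<epsilon>"] floor_correct[of "F i (rep (c y)) / \<epsilon>"]
          unfolding eq by linarith
        then have "F i (rep (c y)) < F i y + \<epsilon>" using \<open>\<epsilon> > 0\<close> by (simp add: field_simps)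
        then show "(\<Sum>r\<in>R. indicator (cell r) y * (F i (rep r) - \<epsilon>)) \<le> F i y"
          by (subst ind[OF y]) simp
      qed
    qed (auto simp: emeasure_eq_measure)
    then show ?thesis
      by (simp add: reindex right_diff_distrib sum_subtractf sum_distrib_right[symmetric] sum1)
  qed
  have "\<exists>T w'. T \<subseteq> rep ` R \<and> card T \<le> d \<and> (\<forall>s\<in>T. 0 < w' s) \<and> sum w' T = 1 \<and>
    (\<forall>i\<in>I. (\<Sum>s\<in>T. w' s * F i s) \<le> (\<Sum>s\<in>rep ` R. w s * F i s))"
  proof (rule caratheodory_below[OF assms(1-3)])
    show "sum w (rep ` R) = 1" using reindex[of "\<lambda>_. 1"] sum1 by simp
  qed (use \<open>finite R\<close> rep F01 in \<open>auto simp: w_def\<close>)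
  then obtain T w' where T: "T \<subseteq> rep ` R" "card T \<le> d" "\<forall>s\<in>T. 0 < w' s" "sum w' T = 1"
    "\<forall>i\<in>I. (\<Sum>s\<in>T. w' s * F i s) \<le> (\<Sum>s\<in>rep ` R. w s * F i s)" by blast
  have "finite T" using T \<open>finite R\<close> finite_subset by blast
  moreover have "T \<subseteq> space M - N" using T rep by blast
  moreover have "\<forall>s\<in>T. Q s" using \<open>T \<subseteq> space M - N\<close> N(1) by blast
  moreover have "\<forall>i\<in>I. (\<Sum>s\<in>T. w' s * F i s) \<le> expectation (F i) + \<epsilon>"
    using T(5) mean by (meson order_trans)
  ultimately show ?thesis using T(2-4) by (intro exI[of _ T] exI[of _ w']) blast
qed

subsection \<open>Discretization of product measures\<close>

definition slice :: "'j set \<Rightarrow> ('j \<Rightarrow> 'a measure) \<Rightarrow> 'j \<Rightarrow> 'a \<Rightarrow> ('j \<Rightarrow> 'a) set \<Rightarrow> ('j \<Rightarrow> 'a) set" where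
  "slice J M j y A = {\<xi> \<in> space (PiM (J - {j}) M). \<xi>(j := y) \<in> A}"

text \<open>Fubini with the factor \<open>j\<close> singled out. The slices are measured in the
  product over \<open>J - {j}\<close>, which does not involve \<open>P\<close>: every choice of
  \<open>P\<close> integrates the same function of \<open>y\<close>, so probabilities are linear in
  the replaced factor.\<close>

lemma slice_measure:
  fixes M :: "'j \<Rightarrow> 'a measure"
  assumes J: "finite J" "j \<in> J" and M: "\<And>k. prob_space (M k)"
    and A: "A \<in> sets (PiM J M)"
  shows measurable_slice_measure:
      "(\<lambda>y. measure (PiM (J - {j}) M) (slice J M j y A)) \<in> borel_measurable (M j)"
    and measure_PiM_fun_upd:
      "prob_space P \<Longrightarrow> sets P = sets (M j) \<Longrightarrow>
        measure (PiM J (M(j := P))) A = (\<integral>y. measure (PiM (J - {j}) M) (slice J M j y A) \<partial>P)"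
proof -
  let ?I = "J - {j}"
  have ins: "insert j ?I = J" using J by auto
  interpret I: prob_space "PiM ?I M" using M by (intro prob_space_PiM)
  have upd[measurable]: "(\<lambda>(\<xi>, y). \<xi>(j := y)) \<in> PiM ?I M \<Otimes>\<^sub>M M j \<rightarrow>\<^sub>M PiM J M"
    using measurable_add_dim[of j ?I M] unfolding ins .
  have Q: "{z \<in> space (M j \<Otimes>\<^sub>M PiM ?I M). (snd z)(j := fst z) \<in> A} \<in> sets (M j \<Otimes>\<^sub>M PiM ?I M)"
  proof -
    have "(\<lambda>z. (\<lambda>(\<xi>, y). \<xi>(j := y)) (snd z, fst z)) \<in> M j \<Otimes>\<^sub>M PiM ?I M \<rightarrow>\<^sub>M PiM J M"
      by measurable
    then have "(\<lambda>z. (snd z)(j := fst z)) \<in> M j \<Otimes>\<^sub>M PiM ?I M \<rightarrow>\<^sub>M PiM J M" by simp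
    from measurable_sets[OF this A] show ?thesis by (simp add: vimage_def Int_def conj_commute)
  qed
  have slice_eq: "slice J M j y A = Pair y -` {z \<in> space (M j \<Otimes>\<^sub>M PiM ?I M). (snd z)(j := fst z) \<in> A}"
    if "y \<in> space (M j)" for y
    using that by (auto simp: slice_def space_pair_measure)
  have slice_sets: "slice J M j y A \<in> sets (PiM ?I M)" if "y \<in> space (M j)" for y
    unfolding slice_eq[OF that] using Q by (rule sets_Pair1)
  have em: "(\<lambda>y. emeasure (PiM ?I M) (slice J M j y A)) \<in> borel_measurable (M j)"
    using I.measurable_emeasure_Pair[OF Q] slice_eq by (subst measurable_cong) auto
  then show meas: "(\<lambda>y. measure (PiM ?I M) (slice J M j y A)) \<in> borel_measurable (M j)"
    unfolding measure_def by measurable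
  assume P: "prob_space P" "sets P = sets (M j)"
  let ?M' = "M(j := P)"
  have M': "prob_space (?M' k)" for k using M P by auto
  interpret P: prob_space P by fact
  interpret product_sigma_finite ?M'
    using M' by unfold_locales (meson prob_space_imp_sigma_finite sigma_finite_measure.sigma_finite_countable)
  interpret J: prob_space "PiM J ?M'" using M' by (intro prob_space_PiM)
  have spaceP: "space P = space (M j)" using P by (metis sets_eq_imp_space_eq)
  have eqI: "PiM ?I ?M' = PiM ?I M" by (intro PiM_cong) auto
  have setsJ: "sets (PiM J ?M') = sets (PiM J M)" using P by (intro sets_PiM_cong) auto
  have A': "A \<in> sets (PiM J ?M')" using A setsJ by simp
  have "emeasure (PiM J ?M') A = (\<integral>\<^sup>+\<xi>. indicator A \<xi> \<partial>PiM (insert j ?I) ?M')"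
    using A' unfolding ins by simp
  also have "\<dots> = (\<integral>\<^sup>+y. \<integral>\<^sup>+\<xi>. indicator A (\<xi>(j := y)) \<partial>PiM ?I ?M' \<partial>?M' j)"
  proof (rule product_nn_integral_insert_rev)
    show "indicator A \<in> borel_measurable (PiM (insert j ?I) ?M')"
      unfolding ins using A' by simp
  qed (use J in auto)
  also have "\<dots> = (\<integral>\<^sup>+y. emeasure (PiM ?I M) (slice J M j y A) \<partial>P)"
  proof (simp only: eqI fun_upd_same, rule nn_integral_cong)
    fix y assume "y \<in> space P"
    then have "(\<integral>\<^sup>+\<xi>. indicator (slice J M j y A) \<xi> \<partial>PiM ?I M) = emeasure (PiM ?I M) (slice J M j y A)"
      using slice_sets spaceP by simp
    then show "(\<integral>\<^sup>+\<xi>. indicator A (\<xi>(j := y)) \<partial>PiM ?I M) = emeasure (PiM ?I M) (slice J M j y A)"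
      by (subst (asm) nn_integral_cong[where v="\<lambda>\<xi>. indicator A (\<xi>(j := y))"])
        (auto simp: slice_def indicator_def)
  qed
  also have "\<dots> = (\<integral>\<^sup>+y. ennreal (measure (PiM ?I M) (slice J M j y A)) \<partial>P)"
    by (simp add: I.emeasure_eq_measure)
  also have "\<dots> = ennreal (\<integral>y. measure (PiM ?I M) (slice J M j y A) \<partial>P)"
  proof (rule nn_integral_eq_integral)
    have "(\<lambda>y. measure (PiM ?I M) (slice J M j y A)) \<in> borel_measurable P"
      using meas by (simp cong: measurable_cong_sets add: P(2))
    then show "integrable P (\<lambda>y. measure (PiM ?I M) (slice J M j y A))"
      by (intro P.integrable_const_bound[where B=1]) auto
  qed simp
  finally show "measure (PiM J ?M') A = (\<integral>y. measure (PiM ?I M) (slice J M j y A) \<partial>P)"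
    by (simp add: J.emeasure_eq_measure Bochner_Integration.integral_nonneg)
qed

text \<open>A point measure on \<open>S\<close> is pushed forward to the sigma-algebra of
  \<open>N\<close>, so that the measurable sets of the product do not change when it replaces a
  factor.\<close>

lemma finite_support_prob_space:
  fixes w :: "'a \<Rightarrow> real"
  assumes S: "finite S" "S \<subseteq> space N" "\<And>s. s \<in> S \<Longrightarrow> {s} \<in> sets N"
    and w: "\<And>s. s \<in> S \<Longrightarrow> 0 < w s" "sum w S = 1"
  shows "\<exists>P. prob_space P \<and> sets P = sets N \<and> measure P S = 1 \<and>
    (\<forall>s\<in>S. measure P {s} = w s) \<and>
    (\<forall>f\<in>borel_measurable N. (\<integral>y. f y \<partial>P) = (\<Sum>s\<in>S. w s * f s :: real))"
proof (intro exI conjI ballI)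
  define Q where "Q = point_measure S (\<lambda>s. ennreal (w s))"
  define P where "P = distr Q N id"
  have id: "id \<in> Q \<rightarrow>\<^sub>M N" using S by (auto simp: Q_def)
  have emQ: "emeasure Q X = ennreal (sum w X)" if "X \<subseteq> S" for X
    using that S w by (simp add: Q_def emeasure_point_measure_finite subset_iff less_imp_le)
  interpret Q: prob_space Q
    by standard (use emQ[of S] w in \<open>simp add: Q_def space_point_measure\<close>)
  show "prob_space P" unfolding P_def by (rule Q.prob_space_distr[OF id])
  show "sets P = sets N" by (simp add: P_def)
  have spQ: "space Q = S" by (simp add: Q_def space_point_measure)
  have S_sets: "S \<in> sets N" using S sets.finite_UN[of S "\<lambda>s. {s}" N] by simp
  have mP: "measure P X = sum w X" if "X \<subseteq> S" "X \<in> sets N" for X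
  proof -
    have "measure P X = measure Q (id -` X \<inter> space Q)"
      unfolding P_def by (rule measure_distr[OF id that(2)])
    also have "id -` X \<inter> space Q = X" using that by (auto simp: spQ)
    finally show ?thesis using emQ[OF that(1)] w that
      by (simp add: measure_def sum_nonneg subset_iff less_imp_le)
  qed
  show "measure P S = 1" using mP[OF _ S_sets] w by simp
  show "measure P {s} = w s" if "s \<in> S" for s using mP[of "{s}"] S that by simp
  show "(\<integral>y. f y \<partial>P) = (\<Sum>s\<in>S. w s * f s)" if "f \<in> borel_measurable N" for f :: "'a \<Rightarrow> real"
  proof -
    have "(\<integral>y. f y \<partial>P) = (\<integral>y. f y \<partial>Q)" unfolding P_def by (subst integral_distr[OF id that]) simp
    also have "\<dots> = (\<Sum>s\<in>S. w s * f s)"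
      unfolding Q_def using S w by (subst lebesgue_integral_point_measure_finite) (auto simp: less_imp_le)
    finally show ?thesis .
  qed
qed

text \<open>One implication is enough, since the two points can be exchanged. Unlike a cylinder
  representation, this form refers to no measure and therefore survives the replacement of
  factors.\<close>

definition determined_by :: "'j set \<Rightarrow> ('j \<Rightarrow> 'a) set \<Rightarrow> ('j \<Rightarrow> 'a) set \<Rightarrow> bool" where
  "determined_by N \<Omega> A \<longleftrightarrow> (\<forall>\<xi>\<in>\<Omega>. \<forall>\<xi>'\<in>\<Omega>. (\<forall>j\<in>N. \<xi> j = \<xi>' j) \<longrightarrow> \<xi> \<in> A \<longrightarrow> \<xi>' \<in> A)"

text \<open>The uncovered set is null, so almost every value of coordinate \<open>j\<close> has a
  null uncovered slice, and sampling may be restricted to such values. Only the events with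
  \<open>j \<in> N i\<close> have slices that vary with the value; there are at most
  \<open>d\<close> of them, and sampling bounds their means. The other events keep their
  probability.\<close>

lemma discretize_coordinate:
  fixes M :: "'j \<Rightarrow> 'a measure" and A :: "'i \<Rightarrow> ('j \<Rightarrow> 'a) set"
  assumes J: "finite J" "j \<in> J" and M: "\<And>k. prob_space (M k)"
    and single: "\<And>s. s \<in> space (M j) \<Longrightarrow> {s} \<in> sets (M j)"
    and I: "finite I" "card {i \<in> I. j \<in> N i} \<le> d" "1 \<le> d"
    and A: "\<And>i. i \<in> I \<Longrightarrow> A i \<in> sets (PiM J M)"
    and det: "\<And>i. i \<in> I \<Longrightarrow> determined_by (N i) (space (PiM J M)) (A i)"
    and cover: "measure (PiM J M) (space (PiM J M) - (\<Union>i\<in>I. A i)) = 0"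
    and "\<epsilon> > 0"
  shows "\<exists>P S. prob_space P \<and> sets P = sets (M j) \<and> finite S \<and> S \<subseteq> space (M j) \<and> card S \<le> d \<and>
    (\<forall>s\<in>S. 0 < measure P {s}) \<and> measure P S = 1 \<and>
    measure (PiM J (M(j := P))) (space (PiM J M) - (\<Union>i\<in>I. A i)) = 0 \<and>
    (\<forall>i\<in>I. measure (PiM J (M(j := P))) (A i) \<le> measure (PiM J M) (A i) + \<epsilon>)"
proof -
  define V where "V = space (PiM J M) - (\<Union>i\<in>I. A i)"
  define \<phi> where "\<phi> B y = measure (PiM (J - {j}) M) (slice J M j y B)" for B y
  interpret Mj: prob_space "M j" by (rule M)
  interpret I: prob_space "PiM (J - {j}) M" using M by (intro prob_space_PiM)
  have V: "V \<in> sets (PiM J M)" unfolding V_def using A I by auto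
  have meas: "\<phi> B \<in> borel_measurable (M j)" if "B \<in> sets (PiM J M)" for B
    unfolding \<phi>_def by (rule measurable_slice_measure[OF J M that])
  have int: "measure (PiM J (M(j := P))) B = (\<integral>y. \<phi> B y \<partial>P)"
    if "prob_space P" "sets P = sets (M j)" "B \<in> sets (PiM J M)" for P B
    unfolding \<phi>_def by (rule measure_PiM_fun_upd[OF J M that(3) that(1,2)])
  have intM: "measure (PiM J M) B = (\<integral>y. \<phi> B y \<partial>M j)" if "B \<in> sets (PiM J M)" for B
    using int[OF M refl that] by simp
  have \<phi>01: "\<phi> B y \<in> {0..1}" for B y by (simp add: \<phi>_def)
  have integ: "integrable (M j) (\<phi> B)" if "B \<in> sets (PiM J M)" for B
    by (rule Mj.integrable_const_bound[where B=1]) (use meas[OF that] \<phi>01 in auto)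
  have "(\<integral>y. \<phi> V y \<partial>M j) = 0" using cover intM[OF V] by (simp add: V_def)
  then have AEV: "AE y in M j. \<phi> V y = 0"
    using integral_nonneg_eq_0_iff_AE[OF integ[OF V]] \<phi>01 by auto
  have "\<exists>S w. finite S \<and> S \<subseteq> space (M j) \<and> card S \<le> d \<and> (\<forall>s\<in>S. \<phi> V s = 0 \<and> 0 < w s) \<and> sum w S = 1 \<and>
    (\<forall>i\<in>{i \<in> I. j \<in> N i}. (\<Sum>s\<in>S. w s * \<phi> (A i) s) \<le> Mj.expectation (\<phi> (A i)) + \<epsilon>)"
    by (rule Mj.finite_sampling_below[OF _ I(2,3) _ _ AEV \<open>\<epsilon> > 0\<close>])
      (use I(1) meas A \<phi>01 in auto)
  then obtain S w where S: "finite S" "S \<subseteq> space (M j)" "card S \<le> d" "\<forall>s\<in>S. \<phi> V s = 0 \<and> 0 < w s"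
    "sum w S = 1"
    "\<forall>i\<in>{i \<in> I. j \<in> N i}. (\<Sum>s\<in>S. w s * \<phi> (A i) s) \<le> Mj.expectation (\<phi> (A i)) + \<epsilon>"
    by (elim exE conjE) (rule that)
  obtain P where P: "prob_space P" "sets P = sets (M j)" "measure P S = 1"
    "\<And>s. s \<in> S \<Longrightarrow> measure P {s} = w s"
    "\<And>f. f \<in> borel_measurable (M j) \<Longrightarrow> (\<integral>y. f y \<partial>P) = (\<Sum>s\<in>S. w s * f s :: real)"
  proof -
    have "\<exists>P. prob_space P \<and> sets P = sets (M j) \<and> measure P S = 1 \<and>
      (\<forall>s\<in>S. measure P {s} = w s) \<and>
      (\<forall>f\<in>borel_measurable (M j). (\<integral>y. f y \<partial>P) = (\<Sum>s\<in>S. w s * f s))"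
      by (rule finite_support_prob_space) (use S single in auto)
    then show ?thesis using that by blast
  qed
  have spP: "space P = space (M j)" using P by (metis sets_eq_imp_space_eq)
  have "measure (PiM J (M(j := P))) V = 0"
    using S by (simp add: int[OF P(1,2) V] P(5)[OF meas[OF V]])
  moreover have "measure (PiM J (M(j := P))) (A i) \<le> measure (PiM J M) (A i) + \<epsilon>" if i: "i \<in> I" for i
  proof (cases "j \<in> N i")
    case True
    then show ?thesis using S(6) i by (simp add: int[OF P(1,2) A] intM[OF A] P(5)[OF meas[OF A]])
  next
    case False
    obtain y0 where y0: "y0 \<in> space (M j)" using Mj.not_empty by blast
    have "\<phi> (A i) y = \<phi> (A i) y0" if y: "y \<in> space (M j)" for y
    proof -
      \<comment> \<open>Changing coordinate \<open>j\<close> alone is invisible to an event that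
        does not depend on it; exchanging \<open>y\<close> and \<open>y'\<close> gives
        equality.\<close>
      have "slice J M j y (A i) \<subseteq> slice J M j y' (A i)"
        if "y \<in> space (M j)" "y' \<in> space (M j)" for y y'
      proof
        fix \<xi> assume \<xi>: "\<xi> \<in> slice J M j y (A i)"
        have "\<xi>(j := z) \<in> space (PiM J M)" if "z \<in> space (M j)" for z
          using \<xi> that J by (auto simp: slice_def space_PiM PiE_iff extensional_def)
        then have "\<xi>(j := y) \<in> space (PiM J M)" "\<xi>(j := y') \<in> space (PiM J M)"
          using that by auto
        moreover have "\<forall>k\<in>N i. (\<xi>(j := y)) k = (\<xi>(j := y')) k" using False by auto
        moreover have "\<xi>(j := y) \<in> A i" using \<xi> by (simp add: slice_def)
        ultimately have "\<xi>(j := y') \<in> A i" using det[OF i] unfolding determined_by_def by blast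
        then show "\<xi> \<in> slice J M j y' (A i)" using \<xi> by (simp add: slice_def)
      qed
      then show ?thesis unfolding \<phi>_def using y y0 by (metis subset_antisym)
    qed
    then have "(\<integral>y. \<phi> (A i) y \<partial>P) = (\<integral>y. \<phi> (A i) y0 \<partial>P)"
      "(\<integral>y. \<phi> (A i) y \<partial>M j) = (\<integral>y. \<phi> (A i) y0 \<partial>M j)"
      by (auto intro!: Bochner_Integration.integral_cong simp only: spP)
    then show ?thesis using \<open>\<epsilon> > 0\<close> P(1) Mj.prob_space
      by (simp add: int[OF P(1,2) A[OF i]] intM[OF A[OF i]] prob_space.prob_space)
  qed
  ultimately show ?thesis using P(1-4) S unfolding V_def
    by (intro exI[of _ P] exI[of _ S]) simp
qed

lemma discretize_coordinates:
  fixes M :: "'j \<Rightarrow> 'a measure" and A :: "'i \<Rightarrow> ('j \<Rightarrow> 'a) set"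
  assumes J: "finite J" and M: "\<And>k. prob_space (M k)"
    and single: "\<And>j s. s \<in> space (M j) \<Longrightarrow> {s} \<in> sets (M j)"
    and I: "finite I" "\<And>j. j \<in> J \<Longrightarrow> card {i \<in> I. j \<in> N i} \<le> d j" "\<And>j. j \<in> J \<Longrightarrow> 1 \<le> d j"
    and A: "\<And>i. i \<in> I \<Longrightarrow> A i \<in> sets (PiM J M)"
    and det: "\<And>i. i \<in> I \<Longrightarrow> determined_by (N i) (space (PiM J M)) (A i)"
    and cover: "measure (PiM J M) (space (PiM J M) - (\<Union>i\<in>I. A i)) = 0"
    and "K \<subseteq> J" "\<epsilon> > 0"
  shows "\<exists>M' S. (\<forall>j. prob_space (M' j) \<and> sets (M' j) = sets (M j)) \<and>
    (\<forall>j\<in>K. finite (S j) \<and> S j \<subseteq> space (M j) \<and> card (S j) \<le> d j \<and>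
      (\<forall>s\<in>S j. 0 < measure (M' j) {s}) \<and> measure (M' j) (S j) = 1) \<and>
    measure (PiM J M') (space (PiM J M) - (\<Union>i\<in>I. A i)) = 0 \<and>
    (\<forall>i\<in>I. measure (PiM J M') (A i) \<le> measure (PiM J M) (A i) + \<epsilon>)"
proof -
  have "finite K" using J \<open>K \<subseteq> J\<close> finite_subset by blast
  then show ?thesis using \<open>K \<subseteq> J\<close> \<open>\<epsilon> > 0\<close>
  proof (induction K arbitrary: \<epsilon> rule: finite_induct)
    case empty
    then show ?case using M cover by (intro exI[of _ M]) (auto intro: less_imp_le)
  next
    case (insert j K)
    \<comment> \<open>Half of the loss is granted to the coordinates in \<open>K\<close>, half to
      the new coordinate \<open>j\<close>.\<close>
    then have "K \<subseteq> J" "\<epsilon> / 2 > 0" by auto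
    from insert.IH[OF this] obtain M' S where
      M': "\<forall>j. prob_space (M' j) \<and> sets (M' j) = sets (M j)" and
      S: "\<forall>j\<in>K. finite (S j) \<and> S j \<subseteq> space (M j) \<and> card (S j) \<le> d j \<and>
        (\<forall>s\<in>S j. 0 < measure (M' j) {s}) \<and> measure (M' j) (S j) = 1" and
      cover': "measure (PiM J M') (space (PiM J M) - (\<Union>i\<in>I. A i)) = 0" and
      le: "\<forall>i\<in>I. measure (PiM J M') (A i) \<le> measure (PiM J M) (A i) + \<epsilon> / 2"
      by (elim exE conjE) (rule that)
    have sp: "space (M' j) = space (M j)" for j using M' by (metis sets_eq_imp_space_eq)
    have spP: "space (PiM J M') = space (PiM J M)" by (simp add: space_PiM sp)
    have setsP: "sets (PiM J M') = sets (PiM J M)" using M' by (intro sets_PiM_cong) auto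
    have "j \<in> J" using insert by auto
    have "\<exists>P S. prob_space P \<and> sets P = sets (M' j) \<and> finite S \<and> S \<subseteq> space (M' j) \<and> card S \<le> d j \<and>
      (\<forall>s\<in>S. 0 < measure P {s}) \<and> measure P S = 1 \<and>
      measure (PiM J (M'(j := P))) (space (PiM J M') - (\<Union>i\<in>I. A i)) = 0 \<and>
      (\<forall>i\<in>I. measure (PiM J (M'(j := P))) (A i) \<le> measure (PiM J M') (A i) + \<epsilon> / 2)"
      by (rule discretize_coordinate[OF J \<open>j \<in> J\<close> _ _ I(1) I(2)[OF \<open>j \<in> J\<close>] I(3)[OF \<open>j \<in> J\<close>]])
        (use A det cover' single \<open>\<epsilon> / 2 > 0\<close> M' in \<open>simp_all add: sp spP setsP\<close>)
    then obtain P T where P: "prob_space P" "sets P = sets (M' j)" and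
      T: "finite T" "T \<subseteq> space (M' j)" "card T \<le> d j" "\<forall>s\<in>T. 0 < measure P {s}" "measure P T = 1" and
      cover'': "measure (PiM J (M'(j := P))) (space (PiM J M') - (\<Union>i\<in>I. A i)) = 0" and
      le': "\<forall>i\<in>I. measure (PiM J (M'(j := P))) (A i) \<le> measure (PiM J M') (A i) + \<epsilon> / 2"
      by (elim exE conjE) (rule that)
    show ?case
    proof (intro exI[of _ "M'(j := P)"] exI[of _ "S(j := T)"] conjI allI ballI)
      fix i assume "i \<in> I"
      then show "measure (PiM J (M'(j := P))) (A i) \<le> measure (PiM J M) (A i) + \<epsilon>"
        using le le' by force
    next
      show "measure (PiM J (M'(j := P))) (space (PiM J M) - (\<Union>i\<in>I. A i)) = 0"
        using cover'' unfolding spP .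
    qed (use M' P T S sp insert.hyps in auto)
  qed
qed

text \<open>An event that depends only on the labels of the coordinates is a finite disjoint union
  of boxes. This computes probabilities in both directions: with labels that number intervals of
  \<open>[0,1]\<close>, and with labels that number the points of a finite support.\<close>

lemma measure_PiM_labels:
  fixes M :: "'j \<Rightarrow> 'a measure" and \<kappa> :: "'j \<Rightarrow> 'a \<Rightarrow> 'k"
  assumes J: "finite J" and M: "\<And>j. prob_space (M j)"
    and \<kappa>: "\<And>j k. j \<in> J \<Longrightarrow> \<kappa> j -` {k} \<inter> space (M j) \<in> sets (M j)"
    and S: "finite S" "S \<subseteq> extensional J"
  shows sets_PiM_labels: "{\<xi> \<in> space (PiM J M). (\<lambda>j\<in>J. \<kappa> j (\<xi> j)) \<in> S} \<in> sets (PiM J M)"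
    and measure_PiM_labels_eq: "measure (PiM J M) {\<xi> \<in> space (PiM J M). (\<lambda>j\<in>J. \<kappa> j (\<xi> j)) \<in> S} =
      (\<Sum>k\<in>S. \<Prod>j\<in>J. measure (M j) (\<kappa> j -` {k j} \<inter> space (M j)))"
proof -
  define B where "B k = (\<Pi>\<^sub>E j\<in>J. \<kappa> j -` {k j} \<inter> space (M j))" for k
  interpret product_sigma_finite M
    using M by unfold_locales (meson prob_space_imp_sigma_finite sigma_finite_measure.sigma_finite_countable)
  interpret P: prob_space "PiM J M" using M by (intro prob_space_PiM)
  have B: "B k \<in> sets (PiM J M)" for k
    unfolding B_def using J \<kappa> by (intro sets_PiM_I_finite) auto
  have eq: "{\<xi> \<in> space (PiM J M). (\<lambda>j\<in>J. \<kappa> j (\<xi> j)) \<in> S} = (\<Union>k\<in>S. B k)"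
  proof (intro set_eqI iffI)
    fix \<xi> assume "\<xi> \<in> {\<xi> \<in> space (PiM J M). (\<lambda>j\<in>J. \<kappa> j (\<xi> j)) \<in> S}"
    then show "\<xi> \<in> (\<Union>k\<in>S. B k)"
      by (intro UN_I[of "\<lambda>j\<in>J. \<kappa> j (\<xi> j)"]) (auto simp: B_def space_PiM PiE_iff)
  next
    fix \<xi> assume "\<xi> \<in> (\<Union>k\<in>S. B k)"
    then obtain k where k: "k \<in> S" "\<xi> \<in> B k" by blast
    then have "(\<lambda>j\<in>J. \<kappa> j (\<xi> j)) = k"
      using S(2) by (intro extensionalityI[of _ J]) (auto simp: B_def PiE_iff)
    then show "\<xi> \<in> {\<xi> \<in> space (PiM J M). (\<lambda>j\<in>J. \<kappa> j (\<xi> j)) \<in> S}"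
      using k by (auto simp: B_def space_PiM PiE_iff)
  qed
  show "{\<xi> \<in> space (PiM J M). (\<lambda>j\<in>J. \<kappa> j (\<xi> j)) \<in> S} \<in> sets (PiM J M)"
    unfolding eq using B S(1) by auto
  have "disjoint_family_on B S"
    unfolding disjoint_family_on_def
  proof (intro ballI impI)
    fix k k' assume kk: "k \<in> S" "k' \<in> S" "k \<noteq> k'"
    \<comment> \<open>Extensionality makes distinct indices differ at a coordinate inside
      \<open>J\<close>, where the boxes then separate.\<close>
    then obtain j where "j \<in> J" "k j \<noteq> k' j" using S(2) by (meson extensionalityI subsetD)
    then show "B k \<inter> B k' = {}" by (auto simp: B_def PiE_iff)
  qed
  then have "measure (PiM J M) (\<Union>k\<in>S. B k) = (\<Sum>k\<in>S. measure (PiM J M) (B k))"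
    using B S(1) by (intro P.finite_measure_finite_Union) auto
  also have "\<dots> = (\<Sum>k\<in>S. \<Prod>j\<in>J. measure (M j) (\<kappa> j -` {k j} \<inter> space (M j)))"
  proof (rule sum.cong[OF refl])
    fix k
    have "emeasure (PiM J M) (B k) = (\<Prod>j\<in>J. emeasure (M j) (\<kappa> j -` {k j} \<inter> space (M j)))"
      unfolding B_def using J \<kappa> by (intro emeasure_PiM) auto
    also have "\<dots> = ennreal (\<Prod>j\<in>J. measure (M j) (\<kappa> j -` {k j} \<inter> space (M j)))"
      using M by (simp add: prod_ennreal finite_measure.emeasure_eq_measure prob_space.finite_measure)
    finally show "measure (PiM J M) (B k) = (\<Prod>j\<in>J. measure (M j) (\<kappa> j -` {k j} \<inter> space (M j)))"
      by (simp add: measure_def prod_nonneg)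
  qed
  finally show "measure (PiM J M) {\<xi> \<in> space (PiM J M). (\<lambda>j\<in>J. \<kappa> j (\<xi> j)) \<in> S} =
      (\<Sum>k\<in>S. \<Prod>j\<in>J. measure (M j) (\<kappa> j -` {k j} \<inter> space (M j)))"
    unfolding eq .
qed

section \<open>The unit interval and its partitions\<close>

lemma space_unit_interval: "space unit_interval = {0..1}"
  by (simp add: unit_interval_def space_restrict_space)

lemma sets_unit_interval: "X \<in> sets unit_interval \<longleftrightarrow> X \<subseteq> {0..1} \<and> X \<in> sets borel"
  by (auto simp: unit_interval_def sets_restrict_space image_iff)

lemma measure_unit_interval: "X \<subseteq> {0..1} \<Longrightarrow> measure unit_interval X = measure lborel X"
  by (simp add: unit_interval_def measure_restrict_space)

lemma prob_space_unit_interval: "prob_space unit_interval"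
  by standard (simp add: space_unit_interval, simp add: unit_interval_def emeasure_restrict_space)

lemma unit_interval_labelling:
  fixes x :: "nat \<Rightarrow> real"
  assumes x: "\<And>k. k \<in> {1..d} \<Longrightarrow> 0 \<le> x k" "(\<Sum>k\<in>{1..d}. x k) = 1"
  shows "\<exists>\<kappa>. \<kappa> \<in> {0..1} \<rightarrow> {1..d} \<and> (\<forall>k. \<kappa> -` {k} \<inter> {0..1} \<in> sets unit_interval) \<and>
    (\<forall>k\<in>{1..d}. measure unit_interval (\<kappa> -` {k} \<inter> {0..1}) = x k)"
proof -
  define s where "s k = (\<Sum>l\<in>{1..k}. x l)" for k
  \<comment> \<open>The cut points are the partial sums \<open>s k\<close>, so label
    \<open>k\<close> occupies an interval of length \<open>x k\<close>. Requiring
    \<open>1 \<le> k\<close> gives the point 0 the label 1, since already \<open>s 0 = 0\<close>;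
    hence the first interval is closed and the later ones are half-open.\<close>
  define \<kappa> where "\<kappa> y = (LEAST k. 1 \<le> k \<and> y \<le> s k)" for y
  have sd: "s d = 1" using x by (simp add: s_def)
  have "d \<ge> 1" using x(2) by (cases d) auto
  have s_Suc: "s (Suc k) = s k + x (Suc k)" for k by (simp add: s_def)
  have s_mono: "s k \<le> s l" if "k \<le> l" "l \<le> d" for k l
    unfolding s_def using that x by (intro sum_mono2) auto
  have range: "\<kappa> y \<in> {1..d}" "y \<le> s (\<kappa> y)" if "y \<le> 1" for y
  proof -
    have d: "1 \<le> d \<and> y \<le> s d" using that sd \<open>d \<ge> 1\<close> by simp
    show "\<kappa> y \<in> {1..d}" "y \<le> s (\<kappa> y)"
      using LeastI[of "\<lambda>k. 1 \<le> k \<and> y \<le> s k", OF d] Least_le[of "\<lambda>k. 1 \<le> k \<and> y \<le> s k", OF d]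
      by (auto simp: \<kappa>_def)
  qed
  have below: "s l < y" if "1 \<le> l" "l < \<kappa> y" for l y
    using not_less_Least[of l "\<lambda>k. 1 \<le> k \<and> y \<le> s k"] that by (auto simp: \<kappa>_def)
  have eqI: "\<kappa> y = k" if "1 \<le> k" "y \<le> s k" "\<And>l. 1 \<le> l \<Longrightarrow> l < k \<Longrightarrow> s l < y" for y k
    unfolding \<kappa>_def using that by (intro Least_equality) (auto simp: not_le[symmetric])
  have one: "\<kappa> -` {1} \<inter> {0..1} = {0..x 1}"
  proof (intro set_eqI iffI)
    fix y assume "y \<in> {0..x 1}"
    moreover from this have "y \<le> 1" using s_mono[of 1 d] \<open>d \<ge> 1\<close> sd by (simp add: s_def)
    ultimately show "y \<in> \<kappa> -` {1} \<inter> {0..1}" using eqI[of 1 y] by (simp add: s_def)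
  next
    fix y assume "y \<in> \<kappa> -` {1} \<inter> {0..1}"
    then show "y \<in> {0..x 1}" using range(2)[of y] by (simp add: s_def)
  qed
  have Suc: "\<kappa> -` {Suc k} \<inter> {0..1} = {s k<..s (Suc k)}" if k: "1 \<le> k" "Suc k \<le> d" for k
  proof (intro set_eqI iffI)
    fix y assume "y \<in> \<kappa> -` {Suc k} \<inter> {0..1}"
    then have "\<kappa> y = Suc k" "y \<le> 1" by auto
    then show "y \<in> {s k<..s (Suc k)}" using range(2)[of y] below[of k y] k by auto
  next
    fix y assume y: "y \<in> {s k<..s (Suc k)}"
    have "0 \<le> s k" using s_mono[of 0 k] k by (simp add: s_def)
    moreover have "s (Suc k) \<le> 1" using s_mono[of "Suc k" d] k sd by simp
    moreover have "\<kappa> y = Suc k"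
    proof (rule eqI)
      fix l assume "1 \<le> l" "l < Suc k"
      then show "s l < y" using s_mono[of l k] k y by auto
    qed (use y in auto)
    ultimately show "y \<in> \<kappa> -` {Suc k} \<inter> {0..1}" using y by auto
  qed
  have *: "\<kappa> -` {k} \<inter> {0..1} \<in> sets borel \<and> measure lborel (\<kappa> -` {k} \<inter> {0..1}) = x k"
    if k: "k \<in> {1..d}" for k
  proof (cases "k = 1")
    case True
    then show ?thesis using one x(1)[of 1] k by simp
  next
    case False
    then obtain l where l: "k = Suc l" "1 \<le> l" using k by (cases k) auto
    then show ?thesis using Suc[of l] k s_Suc[of l] x(1)[of k] by simp
  qed
  have "\<kappa> -` {k} \<inter> {0..1} = {}" if "k \<notin> {1..d}" for k using range(1) that by fastforce
  then have "\<kappa> -` {k} \<inter> {0..1} \<in> sets unit_interval" for k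
    using * by (cases "k \<in> {1..d}") (auto simp: sets_unit_interval)
  then show ?thesis using * range(1) by (intro exI[of _ \<kappa>]) (auto simp: measure_unit_interval)
qed

subsection \<open>Covers and points of the program\<close>

abbreviation borel_cube :: "nat \<Rightarrow> (nat \<Rightarrow> real) measure" where
  "borel_cube m \<equiv> PiM {1..m} (\<lambda>_. unit_interval)"

text \<open>Borel events suffice: by \<open>event_cover_if_not_interior\<close> below, Lebesgue measurable ones can be replaced.\<close>

definition event_cover :: "nat \<Rightarrow> nat \<Rightarrow> (nat \<times> nat) set \<Rightarrow> (nat \<Rightarrow> (nat \<Rightarrow> real) set) \<Rightarrow> bool" where
  "event_cover n m E A \<longleftrightarrow>
    (\<forall>i\<in>{1..n}. A i \<in> sets (borel_cube m) \<and>
      determined_by (left_nbhd E i) (space (borel_cube m)) (A i)) \<and>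
    measure (borel_cube m) (space (borel_cube m) - (\<Union>i\<in>{1..n}. A i)) = 0"

lemma finite_multi_indices: "finite (multi_indices m E)"
  by (auto simp: multi_indices_def intro!: finite_PiE)

text \<open>The program expresses independence by changing one coordinate at a time. The hybrids
  \<open>h L\<close> lead from \<open>k\<close> to \<open>k'\<close> by such changes and never leave
  the index set.\<close>

lemma independent_coordinates_eq:
  assumes "finite J" and k: "k \<in> PiE J D" "k' \<in> PiE J D"
    and agree: "\<And>j. j \<in> J \<Longrightarrow> j \<in> N \<Longrightarrow> k j = k' j"
    and inv: "\<And>j k l. j \<in> J \<Longrightarrow> j \<notin> N \<Longrightarrow> k \<in> PiE J D \<Longrightarrow> l \<in> D j \<Longrightarrow> f (k(j := l)) = f k"
  shows "f k = f k'"
proof -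
  define h where "h L j = (if j \<in> L then k' j else k j)" for L j
  have "f (h L) = f k" if "L \<subseteq> J" for L
  proof -
    have "finite L" using that \<open>finite J\<close> finite_subset by blast
    then show ?thesis using that
    proof (induction L)
      case empty
      then show ?case by (simp add: h_def)
    next
      case (insert j L)
      have eq: "h (insert j L) = (h L)(j := k' j)" by (auto simp: h_def fun_eq_iff)
      have hL: "h L \<in> PiE J D" using k insert by (auto simp: h_def PiE_iff extensional_def)
      show ?case
      proof (cases "j \<in> N")
        case True
        then have "h (insert j L) = h L" using agree insert by (auto simp: h_def fun_eq_iff)
        then show ?thesis using insert by simp
      next
        case False
        then show ?thesis unfolding eq using inv[OF _ False hL, of "k' j"] insert k
          by (auto simp: PiE_iff simp del: fun_upd_apply)
      qed
    qed
  qed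
  from this[of J] have "f (h J) = f k" by simp
  moreover have "h J = k'" using k by (auto simp: h_def fun_eq_iff PiE_iff extensional_def)
  ultimately show ?thesis by simp
qed

text \<open>Label \<open>k\<close> of variable \<open>j\<close> is realised by an interval of length
  \<open>x j k\<close>, and event \<open>i\<close> consists of the points whose labels satisfy
  \<open>C i k = 1\<close>. With program value 1 the vector \<open>p\<close> is simply the vector of
  probabilities.\<close>

lemma event_cover_of_program_feasible:
  assumes feas: "program_feasible n m E p 1 x C"
  shows "\<exists>A. event_cover n m E A \<and> (\<forall>i\<in>{1..n}. measure (borel_cube m) (A i) = p i)"
proof -
  let ?J = "{1..m}" and ?D = "\<lambda>j. {1..right_degree E j}" and ?U = "\<lambda>_::nat. unit_interval"
  have cov: "\<And>k. k \<in> multi_indices m E \<Longrightarrow> (\<Sum>i\<in>{1..n}. C i k) \<ge> 1"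
    and inv: "\<And>i j k l. i \<in> {1..n} \<Longrightarrow> j \<in> ?J \<Longrightarrow> (i, j) \<notin> E \<Longrightarrow> k \<in> multi_indices m E \<Longrightarrow>
        l \<in> ?D j \<Longrightarrow> C i (k(j := l)) = C i k"
    and mean: "\<And>i. i \<in> {1..n} \<Longrightarrow> (\<Sum>k\<in>multi_indices m E. (\<Prod>j\<in>?J. x j (k j)) * C i k) = p i"
    and x: "\<And>j. j \<in> ?J \<Longrightarrow> (\<Sum>k\<in>?D j. x j k) = 1" "\<And>j k. j \<in> ?J \<Longrightarrow> k \<in> ?D j \<Longrightarrow> 0 \<le> x j k"
    and C01: "\<And>i k. i \<in> {1..n} \<Longrightarrow> k \<in> multi_indices m E \<Longrightarrow> C i k \<in> {0, 1}"
    using feas unfolding program_feasible_def by (fastforce+)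
  have "\<forall>j\<in>?J. \<exists>\<kappa>. \<kappa> \<in> {0..1} \<rightarrow> ?D j \<and> (\<forall>k. \<kappa> -` {k} \<inter> {0..1} \<in> sets unit_interval) \<and>
    (\<forall>k\<in>?D j. measure unit_interval (\<kappa> -` {k} \<inter> {0..1}) = x j k)"
    using unit_interval_labelling[OF x(2) x(1)] by blast
  then obtain \<kappa> where \<kappa>: "\<And>j. j \<in> ?J \<Longrightarrow> \<kappa> j \<in> {0..1} \<rightarrow> ?D j"
    "\<And>j k. j \<in> ?J \<Longrightarrow> \<kappa> j -` {k} \<inter> space unit_interval \<in> sets unit_interval"
    "\<And>j k. j \<in> ?J \<Longrightarrow> k \<in> ?D j \<Longrightarrow> measure unit_interval (\<kappa> j -` {k} \<inter> space unit_interval) = x j k"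
    unfolding space_unit_interval by metis
  define lab where "lab \<xi> = (\<lambda>j\<in>?J. \<kappa> j (\<xi> j))" for \<xi>
  have lab: "lab \<xi> \<in> multi_indices m E" if "\<xi> \<in> space (borel_cube m)" for \<xi>
    using that \<kappa>(1) by (fastforce simp: lab_def multi_indices_def space_PiM space_unit_interval PiE_iff)
  define T where "T i = {k \<in> multi_indices m E. C i k = 1}" for i
  have T: "finite (T i)" "T i \<subseteq> extensional ?J" for i
    by (rule finite_subset[OF _ finite_multi_indices]) (auto simp: T_def multi_indices_def PiE_def)
  define A where "A i = {\<xi> \<in> space (borel_cube m). lab \<xi> \<in> T i}" for i
  note labels = measure_PiM_labels[where J="?J" and M="?U" and \<kappa>=\<kappa>, OF _ prob_space_unit_interval \<kappa>(2) T, simplified]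
  have A_sets: "A i \<in> sets (borel_cube m)" for i
    unfolding A_def lab_def using labels(1) by simp
  have "measure (borel_cube m) (A i) = p i" if i: "i \<in> {1..n}" for i
  proof -
    have "measure (borel_cube m) (A i) =
      (\<Sum>k\<in>T i. \<Prod>j\<in>?J. measure unit_interval (\<kappa> j -` {k j} \<inter> space unit_interval))"
      unfolding A_def lab_def using labels(2) by simp
    also have "\<dots> = (\<Sum>k\<in>T i. \<Prod>j\<in>?J. x j (k j))"
      using \<kappa>(3) by (intro sum.cong prod.cong refl) (auto simp: T_def multi_indices_def PiE_iff)
    also have "\<dots> = (\<Sum>k\<in>multi_indices m E. (\<Prod>j\<in>?J. x j (k j)) * C i k)"
      using C01[OF i] finite_multi_indices by (intro sum.mono_neutral_cong_left) (auto simp: T_def)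
    finally show ?thesis using mean[OF i] by simp
  qed
  moreover have "determined_by (left_nbhd E i) (space (borel_cube m)) (A i)" if i: "i \<in> {1..n}" for i
    unfolding determined_by_def
  proof (intro ballI impI)
    fix \<xi> \<xi>' assume \<xi>: "\<xi> \<in> space (borel_cube m)" "\<xi>' \<in> space (borel_cube m)" "\<xi> \<in> A i"
      and agree: "\<forall>j\<in>left_nbhd E i. \<xi> j = \<xi>' j"
    have "C i (lab \<xi>) = C i (lab \<xi>')"
    proof (rule independent_coordinates_eq[where J="?J" and D="?D" and N="left_nbhd E i" and f="C i"])
      show "C i (k(j := l)) = C i k"
        if "j \<in> ?J" "j \<notin> left_nbhd E i" "k \<in> PiE ?J ?D" "l \<in> ?D j" for j k l
        using inv[of i j k l] that i by (auto simp: left_nbhd_def multi_indices_def)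
    qed (use lab \<xi> agree in \<open>auto simp: lab_def multi_indices_def\<close>)
    then show "\<xi>' \<in> A i" using \<xi> lab by (auto simp: A_def T_def)
  qed
  moreover have "space (borel_cube m) - (\<Union>i\<in>{1..n}. A i) = {}"
  proof -
    have "\<exists>i\<in>{1..n}. \<xi> \<in> A i" if \<xi>: "\<xi> \<in> space (borel_cube m)" for \<xi>
    proof (rule ccontr)
      assume "\<not> ?thesis"
      then have "C i (lab \<xi>) = 0" if "i \<in> {1..n}" for i
        using C01[OF that lab[OF \<xi>]] \<xi> lab that by (auto simp: A_def T_def)
      then show False using cov[OF lab[OF \<xi>]] by simp
    qed
    then show ?thesis by blast
  qed
  ultimately show ?thesis using A_sets unfolding event_cover_def
    by (metis measure_empty)
qed


lemma singleton_sets_unit_interval: "s \<in> space unit_interval \<Longrightarrow> {s} \<in> sets unit_interval"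
  by (simp add: space_unit_interval sets_unit_interval)

text \<open>After discretization the product measure is concentrated on a finite grid. The masses of
  the grid values become \<open>x\<close>, and \<open>C\<close> records which grid points belong to
  which event. The probabilities of the discretized events are then the \<open>p i\<close>, which
  exceed the original ones by at most \<open>\<epsilon>\<close>.\<close>

lemma program_feasible_of_event_cover:
  assumes E: "E \<subseteq> {1..n} \<times> {1..m}" and deg: "\<forall>j\<in>{1..m}. right_degree E j \<ge> 1"
    and A: "event_cover n m E A" and "\<epsilon> > 0"
  shows "\<exists>p x C. program_feasible n m E p 1 x C \<and>
    (\<forall>i\<in>{1..n}. p i \<le> measure (borel_cube m) (A i) + \<epsilon>)"
proof -
  let ?J = "{1..m}" and ?D = "\<lambda>j. {1..right_degree E j}" and ?U = "\<lambda>_::nat. unit_interval"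
  have right_nbhd: "{i \<in> {1..n}. j \<in> left_nbhd E i} = right_nbhd E j" for j
    using E by (auto simp: left_nbhd_def right_nbhd_def)
  have "\<exists>M' S. (\<forall>j. prob_space (M' j) \<and> sets (M' j) = sets (?U j)) \<and>
    (\<forall>j\<in>?J. finite (S j) \<and> S j \<subseteq> space (?U j) \<and> card (S j) \<le> right_degree E j \<and>
      (\<forall>s\<in>S j. 0 < measure (M' j) {s}) \<and> measure (M' j) (S j) = 1) \<and>
    measure (PiM ?J M') (space (PiM ?J ?U) - (\<Union>i\<in>{1..n}. A i)) = 0 \<and>
    (\<forall>i\<in>{1..n}. measure (PiM ?J M') (A i) \<le> measure (PiM ?J ?U) (A i) + \<epsilon>)"
  proof (rule discretize_coordinates[where N="left_nbhd E"])
    show "card {i \<in> {1..n}. j \<in> left_nbhd E i} \<le> right_degree E j" for j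
      by (simp only: right_nbhd right_degree_def order_refl)
  qed (use A deg \<open>\<epsilon> > 0\<close> prob_space_unit_interval singleton_sets_unit_interval
      in \<open>auto simp: event_cover_def\<close>)
  then obtain M S where M: "\<forall>j. prob_space (M j) \<and> sets (M j) = sets unit_interval" and
    S: "\<forall>j\<in>?J. finite (S j) \<and> S j \<subseteq> space unit_interval \<and> card (S j) \<le> right_degree E j \<and>
      (\<forall>s\<in>S j. 0 < measure (M j) {s}) \<and> measure (M j) (S j) = 1" and
    cover: "measure (PiM ?J M) (space (borel_cube m) - (\<Union>i\<in>{1..n}. A i)) = 0" and
    le: "\<forall>i\<in>{1..n}. measure (PiM ?J M) (A i) \<le> measure (borel_cube m) (A i) + \<epsilon>"
    by (elim exE conjE) (rule that)
  have prob: "prob_space (M j)" for j using M by blast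
  have spM: "space (M j) = space unit_interval" for j using M by (metis sets_eq_imp_space_eq)
  have sp: "space (PiM ?J M) = space (borel_cube m)" by (simp add: space_PiM spM)
  have setsP: "sets (PiM ?J M) = sets (borel_cube m)" using M by (intro sets_PiM_cong) auto
  interpret product_sigma_finite M
    using prob by unfold_locales (meson prob_space_imp_sigma_finite sigma_finite_measure.sigma_finite_countable)
  interpret P: prob_space "PiM ?J M" using prob by (intro prob_space_PiM)
  have A_sets: "A i \<in> sets (PiM ?J M)" if "i \<in> {1..n}" for i
    using A that unfolding setsP event_cover_def by blast
  have S_ne: "S j \<noteq> {}" if "j \<in> ?J" for j using S that by (metis measure_empty zero_neq_one)
  have single: "{s} \<in> sets (M j)" if "s \<in> S j" "j \<in> ?J" for s j
    using S that M singleton_sets_unit_interval by blast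
  have S_sets: "S j \<in> sets (M j)" if "j \<in> ?J" for j
    using sets.finite_UN[of "S j" "\<lambda>s. {s}" "M j"] S single that by simp
  have "\<forall>j\<in>?J. \<exists>h. bij_betw h {1..card (S j)} (S j)" using S ex_bij_betw_nat_finite_1 by blast
  then obtain h where h: "\<And>j. j \<in> ?J \<Longrightarrow> bij_betw (h j) {1..card (S j)} (S j)" by metis
  \<comment> \<open>If the support is smaller than the degree, its points are repeated rather than padded by points of
      mass \<open>0\<close>: then all points of the grid have positive mass, hence are covered.\<close>
  define y where "y j k = (if k \<in> {1..card (S j)} then h j k else h j 1)" for j k
  \<comment> \<open>The null set outside the support gets label 1, so that every point has a label
    and the \<open>x j k\<close> sum to 1. Labels above \<open>card (S j)\<close> are never taken
    and get probability 0.\<close>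
  define \<kappa> where "\<kappa> j s = (if s \<in> S j then inv_into {1..card (S j)} (h j) s else 1)" for j s
  have y: "y j k \<in> S j" if "j \<in> ?J" for j k
  proof -
    have "1 \<in> {1..card (S j)}" using S_ne[OF that] S that by (simp add: Suc_le_eq card_gt_0_iff)
    then show ?thesis using bij_betwE[OF h[OF that]] by (auto simp: y_def)
  qed
  have \<kappa>_S: "\<kappa> j s \<in> {1..card (S j)} \<and> y j (\<kappa> j s) = s" if "j \<in> ?J" "s \<in> S j" for j s
  proof -
    have img: "s \<in> h j ` {1..card (S j)}" using h[OF that(1)] that(2) by (simp add: bij_betw_def)
    show ?thesis using inv_into_into[OF img] f_inv_into_f[OF img] that by (simp add: \<kappa>_def y_def)
  qed
  have \<kappa>_D: "\<kappa> j s \<in> ?D j" if "j \<in> ?J" for j s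
    using \<kappa>_S[OF that, of s] S deg that by (cases "s \<in> S j") (fastforce simp: \<kappa>_def)+
  have \<kappa>_sets: "\<kappa> j -` {k} \<inter> space (M j) \<in> sets (M j)" if j: "j \<in> ?J" for j k
  proof -
    have "\<kappa> j -` {k} \<inter> S j = (\<Union>s\<in>\<kappa> j -` {k} \<inter> S j. {s})" by auto
    also have "\<dots> \<in> sets (M j)" using S single j by (intro sets.finite_UN) auto
    finally have "\<kappa> j -` {k} \<inter> S j \<in> sets (M j)" .
    moreover have "\<kappa> j -` {k} \<inter> space (M j) =
      (\<kappa> j -` {k} \<inter> S j) \<union> (if k = 1 then space (M j) - S j else {})"
      using S j by (auto simp: \<kappa>_def spM split: if_splits)
    ultimately show ?thesis using S_sets[OF j] by auto
  qed
  define x where "x j k = measure (M j) (\<kappa> j -` {k} \<inter> space (M j))" for j k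
  define z where "z k = (\<lambda>j\<in>?J. y j (k j))" for k
  define C where "C i k = (if z k \<in> A i then 1 else 0 :: real)" for i k
  define p where "p i = (\<Sum>k\<in>multi_indices m E. (\<Prod>j\<in>?J. x j (k j)) * C i k)" for i
  have z_PiE: "z k \<in> PiE ?J S" for k using y by (auto simp: z_def)
  have PiE_sp: "PiE ?J S \<subseteq> space (borel_cube m)"
    unfolding space_PiM using S by (intro PiE_mono) auto
  have sum_x: "(\<Sum>k\<in>?D j. x j k) = 1" if j: "j \<in> ?J" for j
  proof -
    interpret Mj: prob_space "M j" by (rule prob)
    have "(\<Sum>k\<in>?D j. x j k) = Mj.prob (\<Union>k\<in>?D j. \<kappa> j -` {k} \<inter> space (M j))"
      unfolding x_def using \<kappa>_sets[OF j]
      by (intro Mj.finite_measure_finite_Union[symmetric]) (auto simp: disjoint_family_on_def)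
    also have "(\<Union>k\<in>?D j. \<kappa> j -` {k} \<inter> space (M j)) = space (M j)" using \<kappa>_D[OF j] by auto
    finally show ?thesis by (simp add: Mj.prob_space)
  qed
  have covered: "\<exists>i\<in>{1..n}. z k \<in> A i" for k
  proof (rule ccontr)
    assume "\<not> ?thesis"
    then have sub: "{z k} \<subseteq> space (PiM ?J M) - (\<Union>i\<in>{1..n}. A i)"
      using subsetD[OF PiE_sp z_PiE, of k] unfolding sp by blast
    have "{z k} = (\<Pi>\<^sub>E j\<in>?J. {z k j})" by (rule PiE_singleton[symmetric]) (simp add: z_def)
    moreover have "emeasure (PiM ?J M) (\<Pi>\<^sub>E j\<in>?J. {z k j}) = (\<Prod>j\<in>?J. emeasure (M j) {z k j})"
      using single y by (intro emeasure_PiM) (auto simp: z_def)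
    ultimately have "emeasure (PiM ?J M) {z k} = (\<Prod>j\<in>?J. emeasure (M j) {z k j})"
      by simp
    also have "\<dots> = ennreal (\<Prod>j\<in>?J. measure (M j) {z k j})"
      using prob by (simp add: prod_ennreal finite_measure.emeasure_eq_measure prob_space.finite_measure)
    also have "\<dots> > 0" using S y by (auto simp: z_def intro!: prod_pos)
    also have "emeasure (PiM ?J M) {z k} \<le> emeasure (PiM ?J M) (space (PiM ?J M) - (\<Union>i\<in>{1..n}. A i))"
      using sub A_sets by (intro emeasure_mono) auto
    finally show False using cover unfolding sp[symmetric] P.emeasure_eq_measure by simp
  qed
  have AE_S: "AE \<xi> in PiM ?J M. \<xi> \<in> PiE ?J S"
  proof -
    have "PiE ?J S \<in> P.events" using S_sets by (intro sets_PiM_I_finite) auto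
    moreover have "emeasure (PiM ?J M) (PiE ?J S) = 1"
      using S_sets S prob
      by (subst emeasure_PiM)
        (auto simp: finite_measure.emeasure_eq_measure prob_space.finite_measure intro!: prod.neutral)
    ultimately show ?thesis by (intro P.AE_prob_1) (simp add: measure_def)
  qed
  \<comment> \<open>Almost every point lies on the grid, and there \<open>z\<close> recovers the
    point from its labels.\<close>
  have p: "p i = measure (PiM ?J M) (A i)" if i: "i \<in> {1..n}" for i
  proof -
    let ?T = "{k \<in> multi_indices m E. z k \<in> A i}"
    have T: "finite ?T" "?T \<subseteq> extensional ?J"
      by (rule finite_subset[OF _ finite_multi_indices]) (auto simp: multi_indices_def PiE_def)
    note labels = measure_PiM_labels[where J="?J" and M=M and \<kappa>=\<kappa>, OF _ prob \<kappa>_sets T, simplified]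
    have "p i = (\<Sum>k\<in>?T. \<Prod>j\<in>?J. x j (k j))"
      unfolding p_def using finite_multi_indices by (intro sum.mono_neutral_cong_right) (auto simp: C_def)
    also have "\<dots> = measure (PiM ?J M) {\<xi> \<in> space (PiM ?J M). (\<lambda>j\<in>?J. \<kappa> j (\<xi> j)) \<in> ?T}"
      unfolding x_def using labels(2) by simp
    also have "\<dots> = measure (PiM ?J M) (A i)"
    proof (rule P.finite_measure_eq_AE)
      show "AE \<xi> in PiM ?J M. \<xi> \<in> {\<xi> \<in> space (PiM ?J M). (\<lambda>j\<in>?J. \<kappa> j (\<xi> j)) \<in> ?T} \<longleftrightarrow> \<xi> \<in> A i"
        using AE_S AE_space
      proof eventually_elim
        case (elim \<xi>)
        have "z (\<lambda>j\<in>?J. \<kappa> j (\<xi> j)) = \<xi>"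
          using elim \<kappa>_S by (intro extensionalityI[of _ ?J]) (auto simp: z_def PiE_iff)
        moreover have "(\<lambda>j\<in>?J. \<kappa> j (\<xi> j)) \<in> multi_indices m E"
          using \<kappa>_D by (auto simp: multi_indices_def)
        ultimately show ?case using elim by simp
      qed
    qed (use A_sets[OF i] labels(1) in auto)
    finally show ?thesis .
  qed
  have "program_feasible n m E p 1 x C"
    unfolding program_feasible_def
  proof (intro conjI ballI)
    fix k assume "k \<in> multi_indices m E"
    obtain i where i: "i \<in> {1..n}" "z k \<in> A i" using covered by blast
    have "C i k \<le> (\<Sum>i\<in>{1..n}. C i k)" by (rule member_le_sum) (use i in \<open>auto simp: C_def\<close>)
    then show "1 \<le> (\<Sum>i\<in>{1..n}. C i k)" using i by (simp add: C_def)
  next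
    fix ij assume "ij \<in> {1..n} \<times> ?J - E"
    then obtain i j where ij: "ij = (i, j)" "i \<in> {1..n}" "j \<notin> left_nbhd E i"
      by (auto simp: left_nbhd_def)
    \<comment> \<open>The two grid points differ at most in coordinate \<open>j\<close>, on which
      event \<open>i\<close> does not depend.\<close>
    have "z (k(j := k')) \<in> A i \<longleftrightarrow> z k \<in> A i" for k k'
    proof -
      have "z (k(j := k')) l = z k l" if "l \<in> left_nbhd E i" for l using that ij by (auto simp: z_def)
      moreover have "determined_by (left_nbhd E i) (space (borel_cube m)) (A i)"
        using A ij unfolding event_cover_def by blast
      ultimately show ?thesis using z_PiE PiE_sp unfolding determined_by_def by (metis subsetD)
    qed
    then show "case ij of (i, j) \<Rightarrow> \<forall>k\<in>multi_indices m E. \<forall>k'\<in>{1..right_degree E j}. C i (k(j := k')) = C i k"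
      by (simp add: ij C_def)
  next
    show "(\<Sum>k\<in>multi_indices m E. (\<Prod>j\<in>{1..m}. x j (k j)) * C i k) = 1 * p i" for i
      by (simp add: p_def)
    show "x j k \<in> {0..1}" for j k
      unfolding x_def using prob_space.prob_le_1[OF prob] by simp
  qed (use sum_x in \<open>auto simp: C_def\<close>)
  then show ?thesis using p le by (intro exI[of _ p] exI[of _ x] exI[of _ C]) simp
qed

declare One_nat_def [simp del]

interpretation unit_cube: product_prob_space "\<lambda>_. unit_interval" J for J :: "nat set"
  by (rule product_prob_spaceI) (rule prob_space_unit_interval)

subsection \<open>Covers and the interior\<close>

text \<open>Slabs are the pieces by which events are enlarged or trimmed: over a variable of the
  event they keep it determined by its neighbourhood, and their measure is that of
  \<open>X\<close>.\<close>

definition slab :: "nat \<Rightarrow> nat \<Rightarrow> real set \<Rightarrow> (nat \<Rightarrow> real) set" where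
  "slab m j X = {\<xi> \<in> space (borel_cube m). \<xi> j \<in> X}"

lemma
  assumes "j \<in> {1..m}" "X \<in> sets unit_interval"
  shows sets_slab: "slab m j X \<in> sets (borel_cube m)"
    and measure_slab: "measure (borel_cube m) (slab m j X) = measure lborel X"
proof -
  show "slab m j X \<in> sets (borel_cube m)" unfolding slab_def
    using assms by (intro sets_Collect_single') auto
  have "emeasure (borel_cube m) (slab m j X) = emeasure unit_interval X"
    unfolding slab_def using assms by (rule unit_cube.emeasure_PiM_Collect_single)
  then show "measure (borel_cube m) (slab m j X) = measure lborel X"
    using assms measure_unit_interval by (simp add: measure_def sets_unit_interval)
qed

lemma determined_by_Un:
  "determined_by N \<Omega> A \<Longrightarrow> determined_by N \<Omega> B \<Longrightarrow> determined_by N \<Omega> (A \<union> B)"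
  unfolding determined_by_def by blast

lemma determined_by_Diff:
  "determined_by N \<Omega> A \<Longrightarrow> determined_by N \<Omega> B \<Longrightarrow> determined_by N \<Omega> (A - B)"
  unfolding determined_by_def by (metis DiffD1 DiffD2 DiffI)

lemma determined_by_slab: "j \<in> N \<Longrightarrow> determined_by N (space (borel_cube m)) (slab m j X)"
  unfolding determined_by_def slab_def by auto

lemma finite_left_nbhd:
  assumes "E \<subseteq> {1..n} \<times> {1..m}"
  shows "left_nbhd E i \<subseteq> {1..m}" "finite (left_nbhd E i)"
proof -
  show "left_nbhd E i \<subseteq> {1..m}" using assms by (auto simp: left_nbhd_def)
  then show "finite (left_nbhd E i)" using finite_subset by blast
qed

lemma measure_prod_emb:
  assumes "N \<subseteq> {1..m}" "B \<in> sets (PiM N (\<lambda>_. unit_interval))"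
  shows "measure (borel_cube m) (prod_emb {1..m} (\<lambda>_. unit_interval) N B) =
    measure (PiM N (\<lambda>_. unit_interval)) B"
  using unit_cube.emeasure_PiM_emb'[OF assms(1) _ assms(2)] finite_subset[OF assms(1)]
  by (simp add: measure_def)

text \<open>Non-membership yields conforming events whose uncovered part is null. Replacing each
  base by a Borel superset of equal measure can only shrink the uncovered part.\<close>

lemma event_cover_if_not_interior:
  assumes E: "E \<subseteq> {1..n} \<times> {1..m}" and p: "p \<in> {1..n} \<rightarrow> {0<..<1}"
    and "p \<notin> bigraph_interior n m E"
  shows "\<exists>A. event_cover n m E A \<and> (\<forall>i\<in>{1..n}. measure (borel_cube m) (A i) \<le> p i)"
proof -
  let ?U = "\<lambda>_::nat. unit_interval" and ?N = "left_nbhd E"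
  obtain A where A: "conforms n m E A" "\<And>i. i \<in> {1..n} \<Longrightarrow> measure (cube {1..m}) (A i) = p i"
    and null: "\<not> measure (cube {1..m})
         (space (cube {1..m}) \<inter> (\<Inter>i\<in>{1..n}. space (cube {1..m}) - A i)) > 0"
    using assms by (auto simp: bigraph_interior_def)
  have ex: "\<exists>B\<in>sets (PiM (?N i) ?U). A i \<subseteq> prod_emb {1..m} ?U (?N i) B \<and>
      measure (borel_cube m) (prod_emb {1..m} ?U (?N i) B) \<le> p i" if i: "i \<in> {1..n}" for i
  proof -
    obtain B where B: "B \<in> sets (completion (PiM (?N i) ?U))" "A i = prod_emb {1..m} ?U (?N i) B"
      using A i unfolding conforms_def cube_def by blast
    \<comment> \<open>The bound for the cylinder over the Borel superset \<open>B1\<close> is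
      obtained from inside: \<open>B0\<close> and \<open>B1\<close> have equal measure, and the
      cylinder over \<open>B0\<close> lies in \<open>A i\<close>, so both cylinders have measure at
      most \<open>p i\<close>.\<close>
    define B0 where "B0 = main_part (PiM (?N i) ?U) B"
    have B0: "B0 \<in> sets (PiM (?N i) ?U)" "B0 \<subseteq> B"
      "emeasure (completion (PiM (?N i) ?U)) B = emeasure (PiM (?N i) ?U) B0"
      using B(1) main_part_null_part_Un[OF B(1)] unfolding B0_def by (blast, blast, simp)
    obtain B1 where B1: "B1 \<in> sets (PiM (?N i) ?U)" "B \<subseteq> B1"
      "emeasure (completion (PiM (?N i) ?U)) B = emeasure (PiM (?N i) ?U) B1"
      using completion_upper[OF B(1)] by blast
    have "A i \<in> sets (cube {1..m})"
      using A(2)[OF i] p i by (metis measure_notin_sets Pi_iff greaterThanLessThan_iff less_irrefl)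
    then have "measure (cube {1..m}) (prod_emb {1..m} ?U (?N i) B0) \<le> measure (cube {1..m}) (A i)"
      unfolding cube_def B(2) using B0(2)
      by (intro finite_measure.finite_measure_mono prod_emb_mono)
        (auto intro!: finite_measureI simp: unit_cube.emeasure_space_1)
    moreover have "prod_emb {1..m} ?U (?N i) B0 \<in> sets (borel_cube m)"
      using B0(1) finite_left_nbhd[OF E] by (intro measurable_prod_emb) auto
    ultimately have "measure (borel_cube m) (prod_emb {1..m} ?U (?N i) B0) \<le> p i"
      using A(2)[OF i] by (simp add: cube_def)
    then have "measure (borel_cube m) (prod_emb {1..m} ?U (?N i) B1) \<le> p i"
      using B0 B1 finite_left_nbhd[OF E] by (simp add: measure_prod_emb) (simp add: measure_def)
    then show ?thesis using B1 B(2) prod_emb_mono by (intro bexI[of _ B1]) blast+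
  qed
  define B where "B i = (SOME B. B \<in> sets (PiM (?N i) ?U) \<and> A i \<subseteq> prod_emb {1..m} ?U (?N i) B \<and>
      measure (borel_cube m) (prod_emb {1..m} ?U (?N i) B) \<le> p i)" for i
  have B: "B i \<in> sets (PiM (?N i) ?U)" "A i \<subseteq> prod_emb {1..m} ?U (?N i) (B i)"
    "measure (borel_cube m) (prod_emb {1..m} ?U (?N i) (B i)) \<le> p i" if i: "i \<in> {1..n}" for i
    using someI_ex[of "\<lambda>B. B \<in> sets (PiM (?N i) ?U) \<and> A i \<subseteq> prod_emb {1..m} ?U (?N i) B \<and>
      measure (borel_cube m) (prod_emb {1..m} ?U (?N i) B) \<le> p i"] ex[OF i]
    unfolding B_def by blast+
  define A' where "A' i = prod_emb {1..m} ?U (?N i) (B i)" for i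
  have A'_sets: "A' i \<in> sets (borel_cube m)" if "i \<in> {1..n}" for i
    unfolding A'_def using B(1)[OF that] finite_left_nbhd[OF E] by (intro measurable_prod_emb) auto
  have det: "determined_by (?N i) (space (borel_cube m)) (A' i)" for i
    unfolding determined_by_def
  proof (intro ballI impI)
    fix \<xi> \<xi>' assume \<xi>: "\<xi> \<in> space (borel_cube m)" "\<xi>' \<in> space (borel_cube m)"
      "\<forall>j\<in>?N i. \<xi> j = \<xi>' j" "\<xi> \<in> A' i"
    then have "restrict \<xi> (?N i) = restrict \<xi>' (?N i)" by (auto simp: fun_eq_iff)
    then show "\<xi>' \<in> A' i" using \<xi> by (simp add: A'_def prod_emb_iff space_PiM PiE_iff)
  qed
  let ?V = "space (cube {1..m}) \<inter> (\<Inter>i\<in>{1..n}. space (cube {1..m}) - A i)"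
  let ?V' = "space (borel_cube m) - (\<Union>i\<in>{1..n}. A' i)"
  \<comment> \<open>A set of positive measure is measurable, since \<open>measure\<close> is \<open>0\<close> on non-measurable sets.\<close>
  have "A i \<in> sets (cube {1..m})" if "i \<in> {1..n}" for i
    using A(2)[OF that] p that by (metis measure_notin_sets Pi_iff greaterThanLessThan_iff less_irrefl)
  then have "?V \<in> sets (cube {1..m})"
    by (cases "n = 0") (auto intro!: sets.Int sets.finite_INT)
  moreover have "?V' \<subseteq> ?V" using B(2) by (fastforce simp: A'_def cube_def)
  ultimately have "measure (cube {1..m}) ?V' \<le> measure (cube {1..m}) ?V"
    unfolding cube_def
    by (intro finite_measure.finite_measure_mono)
      (auto intro!: finite_measureI simp: unit_cube.emeasure_space_1)
  moreover have "?V' \<in> sets (borel_cube m)" using A'_sets by auto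
  ultimately have "measure (borel_cube m) ?V' \<le> measure (cube {1..m}) ?V" by (simp add: cube_def)
  then have "measure (borel_cube m) ?V' = 0"
    using null by (meson measure_nonneg not_le order_antisym order_trans)
  then show ?thesis using A'_sets det B(3) unfolding event_cover_def
    by (intro exI[of _ A']) (auto simp: A'_def)
qed

lemma conforms_if_determined_by:
  assumes E: "E \<subseteq> {1..n} \<times> {1..m}"
    and A: "\<And>i. i \<in> {1..n} \<Longrightarrow> A i \<in> sets (borel_cube m) \<and>
      determined_by (left_nbhd E i) (space (borel_cube m)) (A i)"
  shows "conforms n m E A"
  unfolding conforms_def
proof
  let ?U = "\<lambda>_::nat. unit_interval"
  fix i assume i: "i \<in> {1..n}"
  let ?N = "left_nbhd E i"
  \<comment> \<open>Coordinates outside the neighbourhood are filled with 0. The filling value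
    cannot affect membership in \<open>A i\<close>, so the preimage under \<open>ext\<close> serves
    as the base of the cylinder.\<close>
  define ext where "ext \<eta> = (\<lambda>j\<in>{1..m}. if j \<in> ?N then \<eta> j else (0::real))" for \<eta>
  have meas: "ext \<in> PiM ?N ?U \<rightarrow>\<^sub>M borel_cube m"
    unfolding ext_def
  proof (rule measurable_restrict)
    fix j assume "j \<in> {1..m}"
    show "(\<lambda>\<eta>. if j \<in> ?N then \<eta> j else 0) \<in> PiM ?N ?U \<rightarrow>\<^sub>M unit_interval"
      by (cases "j \<in> ?N") (auto simp: space_unit_interval)
  qed
  define B where "B = ext -` A i \<inter> space (PiM ?N ?U)"
  have "B \<in> sets (PiM ?N ?U)" unfolding B_def using meas A[OF i] by (intro measurable_sets) auto
  then have "B \<in> sets (cube ?N)" by (auto simp: cube_def)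
  moreover have "A i = prod_emb {1..m} ?U ?N B"
  proof (rule set_eqI)
    fix \<xi>
    show "\<xi> \<in> A i \<longleftrightarrow> \<xi> \<in> prod_emb {1..m} ?U ?N B"
    proof (cases "\<xi> \<in> space (borel_cube m)")
      case True
      have sp: "restrict \<xi> ?N \<in> space (PiM ?N ?U)"
        using True finite_left_nbhd(1)[OF E, of i] by (auto simp: space_PiM PiE_iff)
      have ext_sp: "ext (restrict \<xi> ?N) \<in> space (borel_cube m)"
        using measurable_space[OF meas sp] .
      have agree: "\<forall>j\<in>?N. \<xi> j = ext (restrict \<xi> ?N) j" "\<forall>j\<in>?N. ext (restrict \<xi> ?N) j = \<xi> j"
        using finite_left_nbhd(1)[OF E, of i] by (auto simp: ext_def)
      have "\<xi> \<in> A i \<longleftrightarrow> ext (restrict \<xi> ?N) \<in> A i"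
        using A[OF i] True ext_sp agree unfolding determined_by_def by blast
      then show ?thesis using True sp by (simp add: prod_emb_iff B_def space_PiM PiE_iff)
    next
      case False
      then show ?thesis using sets.sets_into_space[of "A i" "borel_cube m"] A[OF i]
        by (auto simp: prod_emb_iff space_PiM PiE_iff)
    qed
  qed
  ultimately show "\<exists>B\<in>sets (cube ?N). A i = prod_emb {1..m} ?U ?N B" by blast
qed

text \<open>As \<open>t\<close> grows, the measure of the union increases at rate at most 1, from
  that of \<open>A\<close> at \<open>t = 0\<close>, where the slab is null, to 1 at
  \<open>t = 1\<close>. The intermediate value theorem does the rest.\<close>

lemma enlarge_to_measure:
  assumes j: "j \<in> {1..m}" and A: "A \<in> sets (borel_cube m)"
    and c: "measure (borel_cube m) A \<le> c" "c \<le> 1"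
  shows "\<exists>t\<in>{0..1}. measure (borel_cube m) (A \<union> slab m j {0..t}) = c"
proof -
  define f where "f t = measure (borel_cube m) (A \<union> slab m j {0..t})" for t
  have s: "{0..t} \<in> sets unit_interval" "{s<..t} \<in> sets unit_interval" if "t \<le> 1" "0 \<le> s" for s t
    using that by (auto simp: sets_unit_interval)
  have step: "f s \<le> f t \<and> f t \<le> f s + (t - s)" if st: "0 \<le> s" "s \<le> t" "t \<le> 1" for s t
  proof
    show "f s \<le> f t"
      unfolding f_def using sets_slab[OF j s(1)] A st
      by (intro unit_cube.finite_measure_mono sets.Un) (auto simp: slab_def)
    have "f t \<le> measure (borel_cube m) ((A \<union> slab m j {0..s}) \<union> slab m j {s<..t})"
      unfolding f_def using sets_slab[OF j s(1)] sets_slab[OF j s(2)] A st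
      by (intro unit_cube.finite_measure_mono sets.Un) (auto simp: slab_def)
    also have "\<dots> \<le> f s + measure (borel_cube m) (slab m j {s<..t})"
      unfolding f_def using sets_slab[OF j s(1)] sets_slab[OF j s(2)] A st
      by (intro measure_Un_le sets.Un) auto
    also have "measure (borel_cube m) (slab m j {s<..t}) = t - s"
      using measure_slab[OF j s(2)] st by simp
    finally show "f t \<le> f s + (t - s)" .
  qed
  have lip: "1-lipschitz_on {0..1} f"
  proof (rule lipschitz_onI)
    fix s t :: real assume "s \<in> {0..1}" "t \<in> {0..1}"
    then show "dist (f s) (f t) \<le> 1 * dist s t"
      using step[of s t] step[of t s] by (cases "s \<le> t") (auto simp: dist_real_def)
  qed simp
  have f0: "f 0 \<le> c"
  proof -
    have "f 0 \<le> measure (borel_cube m) A + measure (borel_cube m) (slab m j {0..0})"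
      unfolding f_def using sets_slab[OF j s(1)[of 0 0]] A by (intro measure_Un_le) auto
    also have "measure (borel_cube m) (slab m j {0..0}) = 0" using measure_slab[OF j s(1)[of 0 0]] by simp
    finally show ?thesis using c by simp
  qed
  have f1: "c \<le> f 1"
  proof -
    have "1 = measure (borel_cube m) (slab m j {0..1})" using measure_slab[OF j s(1)[of 1 0]] by simp
    also have "measure (borel_cube m) (slab m j {0..1}) \<le> f 1"
      unfolding f_def using sets_slab[OF j s(1)[of 1 0]] A by (intro unit_cube.finite_measure_mono) auto
    finally show ?thesis using c by simp
  qed
  from IVT'[of f 0 c 1] f0 f1 lipschitz_on_continuous_on[OF lip] show ?thesis
    by (auto simp: f_def)
qed

text \<open>The interior refers to exact probabilities, a cover only to upper bounds. Each event is
  raised to probability \<open>p i\<close> by a slab over one of its own variables, which exists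
  because its neighbourhood is nonempty; enlarging events preserves the cover.\<close>

lemma not_interior_if_event_cover:
  assumes E: "E \<subseteq> {1..n} \<times> {1..m}" and p: "\<And>i. i \<in> {1..n} \<Longrightarrow> p i \<le> 1"
    and N: "\<And>i. i \<in> {1..n} \<Longrightarrow> left_nbhd E i \<noteq> {}"
    and A: "event_cover n m E A" "\<And>i. i \<in> {1..n} \<Longrightarrow> measure (borel_cube m) (A i) \<le> p i"
  shows "p \<notin> bigraph_interior n m E"
proof -
  have A_sets: "A i \<in> sets (borel_cube m)"
    and det: "determined_by (left_nbhd E i) (space (borel_cube m)) (A i)" if "i \<in> {1..n}" for i
    using A(1) that by (auto simp: event_cover_def)
  have null: "measure (borel_cube m) (space (borel_cube m) - (\<Union>i\<in>{1..n}. A i)) = 0"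
    using A(1) by (auto simp: event_cover_def)
  have "\<exists>j t. j \<in> left_nbhd E i \<and> t \<in> {0..1} \<and> measure (borel_cube m) (A i \<union> slab m j {0..t}) = p i"
    if i: "i \<in> {1..n}" for i
  proof -
    obtain j where "j \<in> left_nbhd E i" using N[OF i] by blast
    moreover from this have "j \<in> {1..m}" using finite_left_nbhd(1)[OF E] by blast
    ultimately show ?thesis using enlarge_to_measure[OF _ A_sets[OF i] A(2)[OF i] p[OF i]] by blast
  qed
  then obtain j t where jt: "\<And>i. i \<in> {1..n} \<Longrightarrow> j i \<in> left_nbhd E i" "\<And>i. i \<in> {1..n} \<Longrightarrow> t i \<in> {0..1}"
    "\<And>i. i \<in> {1..n} \<Longrightarrow> measure (borel_cube m) (A i \<union> slab m (j i) {0..t i}) = p i"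
    by metis
  define A' where "A' i = A i \<union> slab m (j i) {0..t i}" for i
  have j: "j i \<in> {1..m}" if "i \<in> {1..n}" for i using jt(1)[OF that] finite_left_nbhd(1)[OF E] by blast
  have A'_sets: "A' i \<in> sets (borel_cube m)" if "i \<in> {1..n}" for i
    unfolding A'_def using A_sets[OF that] sets_slab[OF j[OF that]] jt(2)[OF that]
    by (intro sets.Un) (auto simp: sets_unit_interval)
  have "conforms n m E A'"
    using A'_sets det jt(1)
    by (intro conforms_if_determined_by[OF E]) (auto simp: A'_def intro!: determined_by_Un determined_by_slab)
  moreover have "\<forall>i\<in>{1..n}. measure (cube {1..m}) (A' i) = p i"
    using A'_sets jt(3) by (simp add: cube_def A'_def)
  moreover have "measure (cube {1..m})
         (space (cube {1..m}) \<inter> (\<Inter>i\<in>{1..n}. space (cube {1..m}) - A' i)) = 0"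
  proof -
    have "space (cube {1..m}) \<inter> (\<Inter>i\<in>{1..n}. space (cube {1..m}) - A' i) =
      space (borel_cube m) - (\<Union>i\<in>{1..n}. A' i)" by (auto simp: cube_def)
    moreover have "space (borel_cube m) - (\<Union>i\<in>{1..n}. A' i) \<in> sets (borel_cube m)" using A'_sets by auto
    moreover have "measure (borel_cube m) (space (borel_cube m) - (\<Union>i\<in>{1..n}. A' i)) \<le>
      measure (borel_cube m) (space (borel_cube m) - (\<Union>i\<in>{1..n}. A i))"
      using A_sets by (intro unit_cube.finite_measure_mono sets.Diff sets.finite_UN) (auto simp: A'_def)
    ultimately show ?thesis using null
      by (simp add: cube_def) (metis measure_nonneg order_antisym)
  qed
  ultimately show ?thesis unfolding bigraph_interior_def by auto
qed

text \<open>A union bound. It rules out a cover by no events, a cover by a single event of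
  probability below 1, and an optimum equal to 0.\<close>

lemma event_cover_sum_ge_1:
  assumes "event_cover n m E A"
  shows "1 \<le> (\<Sum>i\<in>{1..n}. measure (borel_cube m) (A i))"
proof -
  let ?V = "space (borel_cube m) - (\<Union>i\<in>{1..n}. A i)"
  have A: "A i \<in> sets (borel_cube m)" if "i \<in> {1..n}" for i using assms that by (auto simp: event_cover_def)
  have "1 = measure (borel_cube m) (space (borel_cube m))" by (simp add: unit_cube.P.prob_space)
  also have "\<dots> \<le> measure (borel_cube m) (?V \<union> (\<Union>i\<in>{1..n}. A i))"
    using A by (intro unit_cube.finite_measure_mono sets.Un sets.Diff sets.finite_UN) auto
  also have "\<dots> \<le> measure (borel_cube m) ?V + measure (borel_cube m) (\<Union>i\<in>{1..n}. A i)"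
    using A by (intro measure_Un_le sets.Diff sets.finite_UN) auto
  also have "\<dots> = measure (borel_cube m) (\<Union>i\<in>{1..n}. A i)" using assms by (simp add: event_cover_def)
  also have "\<dots> \<le> (\<Sum>i\<in>{1..n}. measure (borel_cube m) (A i))"
    using A by (intro measure_UNION_le) auto
  finally show ?thesis .
qed

section \<open>Spreading slack along the base graph\<close>

lemma rtrancl_leaves_set:
  assumes "(u, v) \<in> R\<^sup>*" "u \<in> S" "v \<notin> S"
  shows "\<exists>a b. (a, b) \<in> R \<and> a \<in> S \<and> b \<notin> S"
  using assms by (induction rule: rtrancl_induct) blast+

text \<open>Cut \<open>[0,1]\<close> into intervals shorter than \<open>\<delta>\<close>; the
  corresponding slabs cover \<open>B\<close>, so one of them meets \<open>B\<close> in positive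
  measure. The shared endpoints are harmless, as only subadditivity is used.\<close>

lemma slab_of_small_measure:
  assumes j: "j \<in> {1..m}" and B: "B \<in> sets (borel_cube m)" "measure (borel_cube m) B > 0"
    and "\<delta> > 0"
  shows "\<exists>X\<in>sets unit_interval. measure (borel_cube m) (slab m j X) < \<delta> \<and>
    0 < measure (borel_cube m) (B \<inter> slab m j X)"
proof -
  obtain N where N: "inverse (real (Suc N)) < \<delta>" using reals_Archimedean[OF \<open>\<delta> > 0\<close>] by blast
  let ?N = "real (Suc N)"
  define X where "X k = {real k / ?N .. (real k + 1) / ?N}" for k
  have X: "X k \<in> sets unit_interval \<and> measure lborel (X k) = 1 / ?N" if "k \<le> N" for k
    using that by (auto simp: X_def sets_unit_interval field_simps)
  have slab_X: "slab m j (X k) \<in> sets (borel_cube m)" if "k \<le> N" for k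
    using sets_slab[OF j] X[OF that] by blast
  have "B \<subseteq> (\<Union>k\<in>{..N}. B \<inter> slab m j (X k))"
  proof
    fix \<xi> assume \<xi>: "\<xi> \<in> B"
    then have sp: "\<xi> \<in> space (borel_cube m)" using sets.sets_into_space[OF B(1)] by blast
    then have j01: "\<xi> j \<in> {0..1}" using j by (auto simp: space_PiM space_unit_interval PiE_iff)
    have "\<exists>k\<le>N. \<xi> j \<in> X k"
    \<comment> \<open>At the right end the floor would be \<open>N + 1\<close>, one past the last
      interval.\<close>
    proof (cases "\<xi> j = 1")
      case True
      then have "\<xi> j \<in> X N" by (simp add: X_def)
      then show ?thesis by blast
    next
      case False
      define k where "k = nat \<lfloor>\<xi> j * ?N\<rfloor>"
      have "0 \<le> \<xi> j * ?N" "\<xi> j * ?N < ?N" using j01 False by auto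
      then have k: "real k \<le> \<xi> j * ?N" "\<xi> j * ?N < real k + 1" unfolding k_def by linarith+
      then have "real k < ?N" using \<open>\<xi> j * ?N < ?N\<close> by linarith
      then have "k \<le> N" by linarith
      moreover have "\<xi> j \<in> X k" using k by (simp add: X_def field_simps)
      ultimately show ?thesis by blast
    qed
    then show "\<xi> \<in> (\<Union>k\<in>{..N}. B \<inter> slab m j (X k))" using \<xi> sp by (auto simp: slab_def)
  qed
  then have "measure (borel_cube m) B \<le> measure (borel_cube m) (\<Union>k\<in>{..N}. B \<inter> slab m j (X k))"
    using B slab_X by (intro unit_cube.finite_measure_mono sets.finite_UN) auto
  also have "\<dots> \<le> (\<Sum>k\<in>{..N}. measure (borel_cube m) (B \<inter> slab m j (X k)))"
    using B slab_X by (intro measure_UNION_le) auto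
  finally have "\<exists>k\<in>{..N}. 0 < measure (borel_cube m) (B \<inter> slab m j (X k))"
    using B(2) sum_nonpos[of "{..N}" "\<lambda>k. measure (borel_cube m) (B \<inter> slab m j (X k))"]
    by (meson less_le_trans not_less)
  then obtain k where k: "k \<le> N" "0 < measure (borel_cube m) (B \<inter> slab m j (X k))" by auto
  moreover have "measure (borel_cube m) (slab m j (X k)) < \<delta>"
    using measure_slab[OF j] X[OF k(1)] N by (simp add: inverse_eq_divide)
  ultimately show ?thesis using X by blast
qed

text \<open>
  Let \<open>a\<close> be an event with slack and \<open>b\<close> a tight one depending on a common variable \<open>j\<close>. Giving to \<open>a\<close> all
  points whose \<open>j\<close>-th coordinate lies in a short interval makes it possible to remove them from \<open>b\<close>.
\<close>

lemma event_cover_slack_spreads: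
  assumes E: "E \<subseteq> {1..n} \<times> {1..m}" and conn: "base_graph_connected n E"
    and p: "\<And>i. i \<in> {1..n} \<Longrightarrow> 0 < p i"
    and A: "event_cover n m E A" "\<And>i. i \<in> {1..n} \<Longrightarrow> measure (borel_cube m) (A i) \<le> p i"
    and slack: "i0 \<in> {1..n}" "measure (borel_cube m) (A i0) < p i0"
  shows "\<exists>A'. event_cover n m E A' \<and> (\<forall>i\<in>{1..n}. measure (borel_cube m) (A' i) < p i)"
  using A slack
proof (induction "card {i \<in> {1..n}. measure (borel_cube m) (A i) = p i}" arbitrary: A rule: less_induct)
  case less
  let ?\<mu> = "measure (borel_cube m)"
  define S where "S = {i \<in> {1..n}. ?\<mu> (A i) < p i}"
  show ?case
  proof (cases "{1..n} \<subseteq> S")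
    case True
    then show ?thesis using less.prems(1) by (auto simp: S_def)
  next
    case False
    then obtain v where v: "v \<in> {1..n}" "v \<notin> S" by blast
    have "i0 \<in> S" using less.prems by (simp add: S_def)
    moreover have "(i0, v) \<in> (base_graph n E)\<^sup>*"
      using conn v less.prems(3) by (simp add: base_graph_connected_def)
    ultimately obtain a b where ab: "(a, b) \<in> base_graph n E" "a \<in> S" "b \<notin> S"
      using rtrancl_leaves_set v by metis
    then obtain j where j: "j \<in> left_nbhd E a" "j \<in> left_nbhd E b" and ab': "a \<noteq> b" "a \<in> {1..n}" "b \<in> {1..n}"
      by (auto simp: base_graph_def)
    have j': "j \<in> {1..m}" using j finite_left_nbhd(1)[OF E] by blast
    have A_sets: "A i \<in> sets (borel_cube m)"
      and det: "determined_by (left_nbhd E i) (space (borel_cube m)) (A i)" if "i \<in> {1..n}" for i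
      using less.prems(1) that by (auto simp: event_cover_def)
    have b: "?\<mu> (A b) = p b" using ab ab' less.prems(2)[of b] by (simp add: S_def)
    have a: "?\<mu> (A a) < p a" using ab by (simp add: S_def)
    \<comment> \<open>The tight event \<open>b\<close> has measure \<open>p b > 0\<close>. The slab
      is small enough for \<open>a\<close> to keep some slack after absorbing it, and it meets
      \<open>b\<close> in positive measure, so \<open>b\<close> leaves the set of tight events while
      no event enters it.\<close>
    obtain X where X: "X \<in> sets unit_interval" "?\<mu> (slab m j X) < p a - ?\<mu> (A a)"
      "0 < ?\<mu> (A b \<inter> slab m j X)"
      using slab_of_small_measure[OF j' A_sets[OF ab'(3)], of "p a - ?\<mu> (A a)"] a b p[OF ab'(3)] by auto
    note sl = sets_slab[OF j' X(1)]
    define A' where "A' = A(a := A a \<union> slab m j X, b := A b - slab m j X)"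
    have A'_sets: "A' i \<in> sets (borel_cube m)" if "i \<in> {1..n}" for i
      using A_sets[OF that] A_sets[OF ab'(2)] sl by (auto simp: A'_def)
    have A'_det: "determined_by (left_nbhd E i) (space (borel_cube m)) (A' i)" if "i \<in> {1..n}" for i
      using det[OF that] j by (auto simp: A'_def intro!: determined_by_Un determined_by_Diff determined_by_slab)
    have "?\<mu> (space (borel_cube m) - (\<Union>i\<in>{1..n}. A' i)) \<le> ?\<mu> (space (borel_cube m) - (\<Union>i\<in>{1..n}. A i))"
    proof (rule unit_cube.finite_measure_mono)
      have "\<xi> \<in> (\<Union>i\<in>{1..n}. A' i)" if "\<xi> \<in> A i" "i \<in> {1..n}" for \<xi> i
      proof (cases "i = b \<and> \<xi> \<in> slab m j X \<or> i = a")
        case True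
        then have "\<xi> \<in> A' a" using that ab' by (auto simp: A'_def)
        then show ?thesis using ab' by blast
      next
        case False
        then have "\<xi> \<in> A' i" using that by (auto simp: A'_def)
        then show ?thesis using that by blast
      qed
      then show "space (borel_cube m) - (\<Union>i\<in>{1..n}. A' i) \<subseteq> space (borel_cube m) - (\<Union>i\<in>{1..n}. A i)"
        by blast
    qed (use A_sets in auto)
    then have cover': "event_cover n m E A'"
      using less.prems(1) A'_sets A'_det unfolding event_cover_def
      by (metis (no_types, lifting) measure_nonneg order_antisym)
    have a': "?\<mu> (A' a) < p a"
      using measure_Un_le[OF A_sets[OF ab'(2)] sl] X(2) ab' by (simp add: A'_def)
    have "?\<mu> (A b) = ?\<mu> (A b - slab m j X) + ?\<mu> (A b \<inter> slab m j X)"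
      using unit_cube.finite_measure_Diff'[OF A_sets[OF ab'(3)] sl] by simp
    then have b': "?\<mu> (A' b) < p b" using X(3) b by (simp add: A'_def)
    have other: "A' i = A i" if "i \<noteq> a" "i \<noteq> b" for i using that by (simp add: A'_def)
    have le': "?\<mu> (A' i) \<le> p i" if "i \<in> {1..n}" for i
      using a' b' other[of i] less.prems(2)[OF that] by (cases "i = a \<or> i = b") auto
    have i0: "?\<mu> (A' i0) < p i0"
      using a' b' other[of i0] less.prems(4) by (cases "i0 = a \<or> i0 = b") auto
    have "{i \<in> {1..n}. ?\<mu> (A' i) = p i} \<subset> {i \<in> {1..n}. ?\<mu> (A i) = p i}"
    proof
      have "?\<mu> (A i) = p i" if "?\<mu> (A' i) = p i" for i using that a' b' other[of i] by (cases "i = a \<or> i = b") auto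
      then show "{i \<in> {1..n}. ?\<mu> (A' i) = p i} \<subseteq> {i \<in> {1..n}. ?\<mu> (A i) = p i}" by blast
      show "{i \<in> {1..n}. ?\<mu> (A' i) = p i} \<noteq> {i \<in> {1..n}. ?\<mu> (A i) = p i}"
        using b b' ab'(3) by (metis (mono_tags, lifting) less_irrefl mem_Collect_eq)
    qed
    then have "card {i \<in> {1..n}. ?\<mu> (A' i) = p i} < card {i \<in> {1..n}. ?\<mu> (A i) = p i}"
      by (intro psubset_card_mono) auto
    from less.hyps[OF this cover' le' less.prems(3) i0] show ?thesis .
  qed
qed

text \<open>Connectivity supplies the nonempty neighbourhoods: with at least two events each one has
  a neighbour in the base graph. A single event covers only with probability 1, which is excluded
  for interior points.\<close>

lemma not_interior_if_event_cover_connected: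
  assumes E: "E \<subseteq> {1..n} \<times> {1..m}" and conn: "base_graph_connected n E"
    and A: "event_cover n m E A" "\<And>i. i \<in> {1..n} \<Longrightarrow> measure (borel_cube m) (A i) \<le> p i"
  shows "p \<notin> bigraph_interior n m E"
proof
  assume int: "p \<in> bigraph_interior n m E"
  then have p: "p i < 1" if "i \<in> {1..n}" for i using that by (auto simp: bigraph_interior_def Pi_iff)
  have "left_nbhd E i \<noteq> {}" if i: "i \<in> {1..n}" for i
  proof (cases "\<exists>v\<in>{1..n}. v \<noteq> i")
    case True
    then obtain v where "v \<in> {1..n}" "v \<noteq> i" by blast
    then have "(i, v) \<in> (base_graph n E)\<^sup>*" using conn i by (simp add: base_graph_connected_def)
    then obtain w where "(i, w) \<in> base_graph n E" using \<open>v \<noteq> i\<close> by (metis converse_rtranclE)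
    then show ?thesis by (auto simp: base_graph_def)
  next
    case False
    then have "{1..n} = {i}" using i by blast
    then have "1 \<le> measure (borel_cube m) (A i)" using event_cover_sum_ge_1[OF A(1)] by (simp only:) simp
    then show ?thesis using A(2)[OF i] p[OF i] by simp
  qed
  then have "p \<notin> bigraph_interior n m E"
    using p by (intro not_interior_if_event_cover[OF E _ _ A]) (auto intro: less_imp_le)
  with int show False by blast
qed

subsection \<open>Attainment of the optimum\<close>

text \<open>The program with its equations for the probabilities relaxed to upper bounds, which is
  all that discretization provides. The condition \<open>0 \<le> l\<close> bounds the values from
  below, as compactness requires.\<close>

definition program_dominated :: "nat \<Rightarrow> nat \<Rightarrow> (nat \<times> nat) set \<Rightarrow> (nat \<Rightarrow> real) \<Rightarrow> real \<Rightarrow> bool" where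
  "program_dominated n m E q l \<longleftrightarrow> 0 \<le> l \<and>
    (\<exists>p x C. program_feasible n m E p 1 x C \<and> (\<forall>i\<in>{1..n}. p i \<le> l * q i))"

text \<open>Tychonoff's theorem, read on the function type.\<close>

lemma compact_PiE_UNIV:
  fixes S :: "'i \<Rightarrow> 'a::topological_space set"
  assumes "\<And>i. compact (S i)"
  shows "compact (PiE UNIV S)"
proof -
  have "compactin (product_topology (\<lambda>_. euclidean) UNIV) (PiE UNIV S)"
    unfolding compactin_PiE using assms by simp
  then show ?thesis unfolding euclidean_product_topology by simp
qed

text \<open>
  Points \<open>(\<lambda>, x, C)\<close> are viewed in a product space with the topology of pointwise convergence, where
  boxes are compact.
\<close>

lemma program_dominated_minimum:
  assumes ex: "program_dominated n m E q L"
  shows "\<exists>l. program_dominated n m E q l \<and> (\<forall>l'. program_dominated n m E q l' \<longrightarrow> l \<le> l')"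
proof -
  let ?I = "multi_indices m E" and ?D = "\<lambda>j. {1..right_degree E j}"
  define S where "S = {(l :: real, x :: nat \<times> nat \<Rightarrow> real, C :: nat \<times> (nat \<Rightarrow> nat) \<Rightarrow> real).
    (\<forall>k\<in>?I. 1 \<le> (\<Sum>i\<in>{1..n}. C (i, k))) \<and>
    (\<forall>(i, j)\<in>({1..n} \<times> {1..m}) - E. \<forall>k\<in>?I. \<forall>k'\<in>?D j. C (i, k(j := k')) = C (i, k)) \<and>
    (\<forall>i\<in>{1..n}. (\<Sum>k\<in>?I. (\<Prod>j\<in>{1..m}. x (j, k j)) * C (i, k)) \<le> l * q i) \<and>
    (\<forall>j\<in>{1..m}. (\<Sum>k\<in>?D j. x (j, k)) = 1)}"
  define B where "B = {0..L} \<times> (\<Pi>\<^sub>E _\<in>(UNIV :: (nat \<times> nat) set). {0..1::real}) \<times>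
    (\<Pi>\<^sub>E _\<in>(UNIV :: (nat \<times> (nat \<Rightarrow> nat)) set). {0, 1::real})"
  have dominated: "program_dominated n m E q l" if "(l, x, C) \<in> S \<inter> B" for l x C
    unfolding program_dominated_def
  proof (intro conjI exI)
    show "0 \<le> l" using that by (simp add: B_def)
    show "program_feasible n m E (\<lambda>i. \<Sum>k\<in>?I. (\<Prod>j\<in>{1..m}. x (j, k j)) * C (i, k)) 1
      (\<lambda>j k. x (j, k)) (\<lambda>i k. C (i, k))"
    proof -
      have "(l, x, C) \<in> S" using that by blast
      moreover have "x a \<in> {0..1}" "C b \<in> {0, 1}" for a b
        using that unfolding B_def PiE_UNIV_domain Pi_iff by blast+
      ultimately show ?thesis unfolding program_feasible_def S_def by simp
    qed
    show "\<forall>i\<in>{1..n}. (\<Sum>k\<in>?I. (\<Prod>j\<in>{1..m}. x (j, k j)) * C (i, k)) \<le> l * q i"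
      using that by (simp add: S_def)
  qed
  have in_SB: "\<exists>x C. (l, x, C) \<in> S \<inter> B" if dom: "program_dominated n m E q l" "l \<le> L" for l
  proof -
    obtain p x C where feas: "program_feasible n m E p 1 x C" and le: "\<forall>i\<in>{1..n}. p i \<le> l * q i"
      using dom(1) by (auto simp: program_dominated_def)
    \<comment> \<open>A feasible point may take arbitrary values outside the index ranges. They are
      reset to 0, which lies in the box.\<close>
    define x' where "x' = (\<lambda>(j, k). if j \<in> {1..m} \<and> k \<in> ?D j then x j k else 0)"
    define C' where "C' = (\<lambda>(i, k). if i \<in> {1..n} \<and> k \<in> ?I then C i k else 0)"
    have x': "x' (j, k) = x j k" if "j \<in> {1..m}" "k \<in> ?D j" for j k using that by (simp add: x'_def)
    have C': "C' (i, k) = C i k" if "i \<in> {1..n}" "k \<in> ?I" for i k using that by (simp add: C'_def)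
    have upd: "k(j := k') \<in> ?I" if "k \<in> ?I" "j \<in> {1..m}" "k' \<in> ?D j" for k j k'
      using that unfolding multi_indices_def by (auto simp: PiE_iff extensional_def)
    have I: "k j \<in> ?D j" if "k \<in> ?I" "j \<in> {1..m}" for k j
      using that unfolding multi_indices_def by (rule PiE_mem)
    have sums: "(\<Sum>k\<in>?I. (\<Prod>j\<in>{1..m}. x' (j, k j)) * C' (i, k)) = p i" if "i \<in> {1..n}" for i
    proof -
      have "(\<Sum>k\<in>?I. (\<Prod>j\<in>{1..m}. x' (j, k j)) * C' (i, k)) =
        (\<Sum>k\<in>?I. (\<Prod>j\<in>{1..m}. x j (k j)) * C i k)"
        using x' C' I that by (intro sum.cong refl arg_cong2[where f="(*)"] prod.cong) blast+
      then show ?thesis using feas that unfolding program_feasible_def by simp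
    qed
    have "(\<Sum>i\<in>{1..n}. C' (i, k)) = (\<Sum>i\<in>{1..n}. C i k)" if "k \<in> ?I" for k
      using C' that by (intro sum.cong) auto
    moreover have "(\<Sum>k\<in>?D j. x' (j, k)) = (\<Sum>k\<in>?D j. x j k)" if "j \<in> {1..m}" for j
      using x' that by (intro sum.cong) auto
    moreover have "C' (i, k(j := k')) = C' (i, k)"
      if "(i, j) \<in> ({1..n} \<times> {1..m}) - E" "k \<in> ?I" "k' \<in> ?D j" for i j k k'
    proof -
      have "i \<in> {1..n}" "j \<in> {1..m}" using that by auto
      moreover have "\<forall>(i, j)\<in>({1..n} \<times> {1..m}) - E. \<forall>k\<in>?I. \<forall>k'\<in>?D j. C i (k(j := k')) = C i k"
        using feas unfolding program_feasible_def by blast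
      then have "C i (k(j := k')) = C i k" using that by blast
      ultimately show ?thesis using C'[of i] upd[of k j k'] that(2,3) by simp
    qed
    moreover have "\<forall>k\<in>?I. 1 \<le> (\<Sum>i\<in>{1..n}. C i k)" "\<forall>j\<in>{1..m}. (\<Sum>k\<in>?D j. x j k) = 1"
      using feas unfolding program_feasible_def by blast+
    ultimately have "(l, x', C') \<in> S" using sums le unfolding S_def by (simp, clarsimp)
    moreover have "(l, x', C') \<in> B"
    proof -
      have "\<forall>j\<in>{1..m}. \<forall>k\<in>?D j. x j k \<in> {0..1}" "\<forall>i\<in>{1..n}. \<forall>k\<in>?I. C i k \<in> {0, 1}"
        using feas unfolding program_feasible_def by blast+
      then have "x' a \<in> {0..1}" "C' b \<in> {0, 1}" for a b
        by (cases a, cases b, auto simp: x'_def C'_def)+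
      moreover have "l \<in> {0..L}" using dom by (simp add: program_dominated_def)
      ultimately show ?thesis unfolding B_def PiE_UNIV_domain by blast
    qed
    ultimately show ?thesis by blast
  qed
  have "compact B" unfolding B_def by (intro compact_Times compact_PiE_UNIV) auto
  moreover have "closed S"
  proof -
    have coord_x: "continuous_on UNIV (\<lambda>z :: real \<times> (nat \<times> nat \<Rightarrow> real) \<times> (nat \<times> (nat \<Rightarrow> nat) \<Rightarrow> real).
        fst (snd z) a)" for a
      by (rule continuous_on_compose2[OF continuous_on_product_coordinates[of a], where f="\<lambda>z. fst (snd z)"])
        (auto intro!: continuous_on_fst continuous_on_snd continuous_on_id)
    have coord_C: "continuous_on UNIV (\<lambda>z :: real \<times> (nat \<times> nat \<Rightarrow> real) \<times> (nat \<times> (nat \<Rightarrow> nat) \<Rightarrow> real).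
        snd (snd z) a)" for a
      by (rule continuous_on_compose2[OF continuous_on_product_coordinates[of a], where f="\<lambda>z. snd (snd z)"])
        (auto intro!: continuous_on_fst continuous_on_snd continuous_on_id)
    \<comment> \<open>Every condition in \<open>S\<close> is an equation or a weak inequality
      between continuous functions of finitely many coordinates.\<close>
    show ?thesis
      unfolding S_def case_prod_beta Ball_def
      by (intro closed_Collect_conj closed_Collect_all closed_Collect_imp open_Collect_const
          closed_Collect_le closed_Collect_eq continuous_intros coord_x coord_C)
  qed
  ultimately have "compact (S \<inter> B)" by (metis Int_commute compact_Int_closed)
  moreover have "S \<inter> B \<noteq> {}" using in_SB[OF ex order_refl] by blast
  ultimately have "\<exists>z\<in>S \<inter> B. \<forall>z'\<in>S \<inter> B. fst z \<le> fst z'"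
    by (intro continuous_attains_inf continuous_on_fst continuous_on_id)
  then obtain l x C where l: "(l, x, C) \<in> S \<inter> B" "\<forall>z'\<in>S \<inter> B. l \<le> fst z'" by force
  have "l \<le> l'" if "program_dominated n m E q l'" for l'
  proof (cases "l' \<le> L")
    case True
    then show ?thesis using in_SB[OF that] l(2) by force
  next
    case False
    then show ?thesis using l(1) by (simp add: B_def)
  qed
  then show ?thesis using dominated[OF l(1)] by blast
qed

lemma program_dominated_nonempty:
  assumes deg: "\<forall>j\<in>{1..m}. right_degree E j \<ge> 1" and "1 \<le> n"
    and q: "\<And>i. i \<in> {1..n} \<Longrightarrow> 0 < q i"
  shows "\<exists>l. program_dominated n m E q l"
proof -
  \<comment> \<open>All mass sits on the value 1, which exists because degrees are positive, and
    every event is certain. The common probability \<open>p\<close> is not evaluated; the sum of the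
    quotients \<open>\<bar>p\<bar> / q i\<close> dominates each of them in any case.\<close>
  define x :: "nat \<Rightarrow> nat \<Rightarrow> real" where "x j k = (if k = 1 then 1 else 0)" for j k
  define p where "p = (\<Sum>k\<in>multi_indices m E. \<Prod>j\<in>{1..m}. x j (k j))"
  have "program_feasible n m E (\<lambda>_. p) 1 x (\<lambda>_ _. 1)"
    using deg \<open>1 \<le> n\<close> unfolding program_feasible_def p_def by (auto simp: x_def)
  moreover have "p \<le> (\<Sum>i\<in>{1..n}. \<bar>p\<bar> / q i) * q i" if i: "i \<in> {1..n}" for i
  proof -
    have "p \<le> \<bar>p\<bar> / q i * q i" using q[OF i] by simp
    also have "\<bar>p\<bar> / q i \<le> (\<Sum>i\<in>{1..n}. \<bar>p\<bar> / q i)"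
      using q i by (intro member_le_sum) (auto intro!: divide_nonneg_pos)
    finally show ?thesis using q[OF i] by simp
  qed
  moreover have "0 \<le> (\<Sum>i\<in>{1..n}. \<bar>p\<bar> / q i)"
    using q by (intro sum_nonneg divide_nonneg_pos) auto
  ultimately show ?thesis unfolding program_dominated_def by blast
qed

lemma program_feasible_scale:
  "program_feasible n m E q l x C \<longleftrightarrow> program_feasible n m E (\<lambda>i. l * q i) 1 x C"
  by (simp add: program_feasible_def)

subsection \<open>The boundary as the optimum of the program\<close>

theorem theorem3:
  fixes n m :: nat and E :: "(nat \<times> nat) set" and q :: "nat \<Rightarrow> real" and l :: real
  assumes "E \<subseteq> {1..n} \<times> {1..m}"
    and "base_graph_connected n E"
    and "\<forall>j\<in>{1..m}. right_degree E j \<ge> 1"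
    and "q \<in> {1..n} \<rightarrow> {0<..<1}"
    and "l > 0"
  shows "(\<lambda>i. l * q i) \<in> bigraph_boundary n m E \<longleftrightarrow> program_optimal_value n m E q l"
proof (cases "n = 0")
  case True
  \<comment> \<open>Without events nothing can be covered: every vector is interior, so the boundary
    is empty, and the program is infeasible. Both sides of the equivalence are false.\<close>
  have no_cover: "\<not> event_cover n m E A" for A using event_cover_sum_ge_1[of n m E A] True by auto
  have "p \<in> bigraph_interior n m E" for p
    using event_cover_if_not_interior[OF assms(1), of p] no_cover True by auto
  then have "(\<lambda>i. l * q i) \<notin> bigraph_boundary n m E"
    unfolding bigraph_boundary_def by (auto intro!: exI[of _ "1 / 2 :: real"])
  moreover have "\<not> program_feasible n m E q l x C" for x C
    using event_cover_of_program_feasible no_cover program_feasible_scale by blast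
  ultimately show ?thesis by (simp add: program_optimal_value_def)
next
  case False
  then have n: "1 \<le> n" "{1..n} \<noteq> {}" by auto
  have q: "0 < q i" "q i < 1" if "i \<in> {1..n}" for i using assms(4) that by auto
  obtain s where s: "program_dominated n m E q s"
    and s_min: "\<And>l'. program_dominated n m E q l' \<Longrightarrow> s \<le> l'"
  proof -
    obtain L where "program_dominated n m E q L"
      using program_dominated_nonempty[OF assms(3) n(1)] q(1) by blast
    from program_dominated_minimum[OF this] show ?thesis using that by blast
  qed
  have cover_ge: "s \<le> t"
    if t: "0 \<le> t" "event_cover n m E A" "\<And>i. i \<in> {1..n} \<Longrightarrow> measure (borel_cube m) (A i) \<le> t * q i" for t A
  proof (rule field_le_epsilon)
    fix \<delta> :: real assume "\<delta> > 0"
    \<comment> \<open>With the loss \<open>\<delta> * r\<close> the additive error is at most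
      \<open>\<delta> * q i\<close> for every event, so it is absorbed by raising the factor from
      \<open>t\<close> to \<open>t + \<delta>\<close>.\<close>
    define r where "r = Min (q ` {1..n})"
    have "r > 0" unfolding r_def using q n by simp
    have r_le: "r \<le> q i" if "i \<in> {1..n}" for i unfolding r_def using that by simp
    obtain p x C where "program_feasible n m E p 1 x C"
      and p: "\<forall>i\<in>{1..n}. p i \<le> measure (borel_cube m) (A i) + \<delta> * r"
      using program_feasible_of_event_cover[OF assms(1,3) t(2), of "\<delta> * r"] \<open>\<delta> > 0\<close> \<open>r > 0\<close> by auto
    moreover have "p i \<le> (t + \<delta>) * q i" if i: "i \<in> {1..n}" for i
    proof -
      have "\<delta> * r \<le> \<delta> * q i" using r_le[OF i] \<open>\<delta> > 0\<close> by simp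
      then show ?thesis using bspec[OF p i] t(3)[OF i] by (simp add: distrib_right)
    qed
    ultimately have "program_dominated n m E q (t + \<delta>)"
      using t(1) \<open>\<delta> > 0\<close> unfolding program_dominated_def by (meson add_nonneg_nonneg less_imp_le)
    then show "s \<le> t + \<delta>" by (rule s_min)
  qed
  obtain p x C where feas: "program_feasible n m E p 1 x C" and p_le: "\<And>i. i \<in> {1..n} \<Longrightarrow> p i \<le> s * q i"
    and "0 \<le> s"
    using s unfolding program_dominated_def by blast
  obtain A where A: "event_cover n m E A" "\<And>i. i \<in> {1..n} \<Longrightarrow> measure (borel_cube m) (A i) = p i"
    using event_cover_of_program_feasible[OF feas] by blast
  have "s > 0"
  proof (rule ccontr)
    assume "\<not> s > 0"
    then have "s = 0" using \<open>0 \<le> s\<close> by simp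
    then have "measure (borel_cube m) (A i) \<le> 0" if "i \<in> {1..n}" for i using A(2) p_le that by force
    then have "(\<Sum>i\<in>{1..n}. measure (borel_cube m) (A i)) \<le> 0" by (rule sum_nonpos)
    then show False using event_cover_sum_ge_1[OF A(1)] by simp
  qed
  have p_eq: "p i = s * q i" if i: "i \<in> {1..n}" for i
  proof (rule ccontr)
    assume "p i \<noteq> s * q i"
    then have "measure (borel_cube m) (A i) < s * q i" using A(2)[OF i] p_le[OF i] by simp
    then obtain A' where A': "event_cover n m E A'"
      "\<And>i. i \<in> {1..n} \<Longrightarrow> measure (borel_cube m) (A' i) < s * q i"
      using event_cover_slack_spreads[OF assms(1,2) _ A(1) _ i, of "\<lambda>i. s * q i"] A(2) p_le q \<open>s > 0\<close>
      by auto
    \<comment> \<open>The least factor whose multiple of \<open>q\<close> bounds the probabilities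
      of the new cover. Being a maximum of finitely many ratios below \<open>s\<close>, it is itself
      below \<open>s\<close>.\<close>
    define t where "t = Max ((\<lambda>i. measure (borel_cube m) (A' i) / q i) ` {1..n})"
    have t_ge: "measure (borel_cube m) (A' i) / q i \<le> t" if "i \<in> {1..n}" for i
      unfolding t_def using that by (intro Max_ge) auto
    have "measure (borel_cube m) (A' i) / q i < s" if "i \<in> {1..n}" for i
      using A'(2)[OF that] q[OF that] by (simp add: divide_less_eq)
    then have "t < s" unfolding t_def using n by simp
    moreover have "0 \<le> t" using t_ge[OF i] q[OF i] by (meson divide_nonneg_pos measure_nonneg order_trans)
    then have "s \<le> t"
      using A'(1) by (rule cover_ge) (use t_ge q in \<open>simp add: divide_le_eq\<close>)
    ultimately show False by simp
  qed
  have feas_s: "program_feasible n m E q s x C"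
    using feas p_eq unfolding program_feasible_def by simp
  \<comment> \<open>Every value of the exact program is a value of the relaxed one, hence at least
    \<open>s\<close>, and \<open>s\<close> is attained with equality. Nonnegativity of a program
    value follows from realising it by events.\<close>
  have optimal: "program_optimal_value n m E q l \<longleftrightarrow> l = s"
  proof -
    have dominated: "program_dominated n m E q l'" if feas': "program_feasible n m E q l' x' C'" for l' x' C'
    proof -
      have feas'': "program_feasible n m E (\<lambda>i. l' * q i) 1 x' C'" using feas' program_feasible_scale by blast
      then obtain A' where "\<forall>i\<in>{1..n}. measure (borel_cube m) (A' i) = l' * q i"
        using event_cover_of_program_feasible by blast
      then have "0 \<le> l' * q 1" using n by (metis atLeastAtMost_iff measure_nonneg order_refl)
      then have "0 \<le> l'" using q[of 1] n by (simp add: zero_le_mult_iff)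
      then show ?thesis using feas'' unfolding program_dominated_def by blast
    qed
    then show ?thesis
      using s_min feas_s unfolding program_optimal_value_def by (meson order_antisym)
  qed
  have not_interior: "(\<lambda>i. t * q i) \<notin> bigraph_interior n m E" if "s \<le> t" for t
    using not_interior_if_event_cover_connected[OF assms(1,2) A(1)] A(2) p_eq that q
    by (simp add: mult_right_mono less_imp_le)
  have interior: "(\<lambda>i. t * q i) \<in> bigraph_interior n m E" if t: "0 < t" "t < s" for t
  proof (rule ccontr)
    assume *: "(\<lambda>i. t * q i) \<notin> bigraph_interior n m E"
    \<comment> \<open>This excludes that the vector fails to be interior merely by leaving the open
      unit cube; the bound holds because \<open>s * q i\<close> is a probability.\<close>
    have "t * q i < 1" if i: "i \<in> {1..n}" for i
    proof -
      have "t * q i < s * q i" using t q[OF i] by simp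
      also have "\<dots> \<le> 1" using A(2)[OF i] p_eq[OF i] unit_cube.P.prob_le_1 by metis
      finally show ?thesis .
    qed
    then have "(\<lambda>i. t * q i) \<in> {1..n} \<rightarrow> {0<..<1}" using q t by simp
    from event_cover_if_not_interior[OF assms(1) this *] obtain A' where
      "event_cover n m E A'" "\<forall>i\<in>{1..n}. measure (borel_cube m) (A' i) \<le> t * q i" by blast
    then have "s \<le> t" using cover_ge[of t A'] t by simp
    with t show False by simp
  qed
  have "(\<lambda>i. l * q i) \<in> bigraph_boundary n m E \<longleftrightarrow> l = s"
  proof
    assume "(\<lambda>i. l * q i) \<in> bigraph_boundary n m E"
    then have b: "(\<lambda>i. (1 - \<epsilon>) * l * q i) \<in> bigraph_interior n m E"
      "(\<lambda>i. (1 + \<epsilon>) * l * q i) \<notin> bigraph_interior n m E" if "\<epsilon> \<in> {0<..<1}" for \<epsilon>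
      using that by (auto simp: bigraph_boundary_def mult.assoc)
    show "l = s"
    proof (rule linorder_cases[of l s])
      assume "l < s"
      \<comment> \<open>Leaves room for a factor \<open>1 + \<epsilon>\<close> with
        \<open>\<epsilon> < 1\<close> that keeps the vector strictly below the threshold
        \<open>s\<close>.\<close>
      then have "0 < min 1 (s / l - 1)" using assms(5) by simp
      from dense[OF this] obtain \<epsilon> where \<epsilon>: "0 < \<epsilon>" "\<epsilon> < 1" "\<epsilon> < s / l - 1" by auto
      from \<epsilon>(3) have "(1 + \<epsilon>) * l < s" using assms(5) by (simp add: field_simps)
      then show ?thesis using interior[of "(1 + \<epsilon>) * l"] b(2)[of \<epsilon>] \<epsilon> assms(5) by simp
    next
      assume "s < l"
      \<comment> \<open>For this \<open>\<epsilon>\<close> the factor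
        \<open>(1 - \<epsilon>) * l\<close> is exactly \<open>s\<close>, which is already outside
        the interior.\<close>
      then have "1 - s / l \<in> {0<..<1}" using \<open>s > 0\<close> by simp
      from b(1)[OF this] show ?thesis using not_interior[of s] assms(5) by simp
    qed
  next
    assume "l = s"
    have "s * q i \<le> 1" if "i \<in> {1..n}" for i
      using A(2)[OF that] p_eq[OF that] unit_cube.P.prob_le_1 by metis
    moreover have "(\<lambda>i. (1 - \<epsilon>) * (s * q i)) \<in> bigraph_interior n m E" if "\<epsilon> \<in> {0<..<1}" for \<epsilon>
      using interior[of "(1 - \<epsilon>) * s"] that \<open>s > 0\<close> by (simp add: mult.assoc)
    moreover have "(\<lambda>i. (1 + \<epsilon>) * (s * q i)) \<notin> bigraph_interior n m E" if "\<epsilon> \<in> {0<..<1}" for \<epsilon>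
      using not_interior[of "(1 + \<epsilon>) * s"] that \<open>s > 0\<close> by (simp add: mult.assoc)
    ultimately show "(\<lambda>i. l * q i) \<in> bigraph_boundary n m E"
      using q \<open>s > 0\<close> unfolding bigraph_boundary_def \<open>l = s\<close> by auto
  qed
  then show ?thesis using optimal by simp
qed

end
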